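(* Let $k\ge1$ be an integer and $\epsilon_1,\epsilon_2\in\{+,-\}$. Then the following two assertions are equivalent: (i) $C_k^>\cap(\mathbb{R}_{\epsilon_1}\times\mathbb{R}_{\epsilon_2})$ and $C_k^<\cap(\mathbb{R}_{\epsilon_1}\times\mathbb{R}_{\epsilon_2})$ are both nonempty; (ii) $C_{k+1}^>\cap(\mathbb{R}_{\epsilon_1}\times\mathbb{R}_{\epsilon_2})$ or $C_{k+1}^<\cap(\mathbb{R}_{\epsilon_1}\times\mathbb{R}_{\epsilon_2})$ is nonempty. Moreover, both $C_k^>$ and $C_k^<$ are strictly below (resp. strictly above) $C_{k+1}^>$ and $C_{k+1}^<$ in the quadrants $\mathbb{R}_+\times\mathbb{R}_+$ and $\mathbb{R}_-\times\mathbb{R}_+$ (resp. $\mathbb{R}_+\times\mathbb{R}_-$ and $\mathbb{R}_-\times\mathbb{R}_-$).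
   Context: Let $T_1<T_2$ be real numbers, $p,q,m,n\in C[T_1,T_2]$ with $p(t)>0$ and $q(t)\ge 0$ on $[T_1,T_2]$, $m\not\equiv 0$, $n\not\equiv0$, and $Lu:=-[p(t)u']'+q(t)u$. Write $u^\pm:=\max\{\pm u,0\}$, $\mathbb{R}_+=[0,+\infty[$, $\mathbb{R}_-=\,]-\infty,0]$. Consider the problem $$Lu=a\,m(t)u^+-b\,n(t)u^-\ \text{in } ]T_1,T_2[,\qquad u'(T_1)=0=u'(T_2).\qquad(P)$$ For $k\ge0$, $C_k^>$ (resp. $C_k^<$) is the set of $(a,b)\in\mathbb{R}^2$ such that $(P)$ has a nontrivial solution with exactly $k$ zeros in $]T_1,T_2[$ and with $u(T_2)>0$ (resp. $u(T_2)<0$). A set $C$ is strictly below (resp. strictly above) a set $C'$ in a quadrant $Q$ if, whenever $(a,b)\in C\cap Q$ and $(a,b')\in C'\cap Q$ have the same first coordinate, $b<b'$ (resp. $b>b'$). *)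

theory Defs
  imports "HOL-Analysis.Analysis"
begin

(* u' is the derivative of u on [T1,T2] (one-sided at the endpoints) and w is
   (p u')'.  Since p is only continuous, u itself need not be twice differentiable.
   Continuity of w follows from the equation, so it is not required separately. *)
definition neumann_solution ::
  "real \<Rightarrow> real \<Rightarrow> (real \<Rightarrow> real) \<Rightarrow> (real \<Rightarrow> real) \<Rightarrow> (real \<Rightarrow> real) \<Rightarrow> (real \<Rightarrow> real)
    \<Rightarrow> real \<Rightarrow> real \<Rightarrow> (real \<Rightarrow> real) \<Rightarrow> bool" where
  "neumann_solution T1 T2 p q m n a b u \<longleftrightarrow>
    (\<exists>u' w.
      (\<forall>t\<in>{T1..T2}. (u has_real_derivative u' t) (at t within {T1..T2})) \<and>
      continuous_on {T1..T2} u' \<and>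
      (\<forall>t\<in>{T1<..<T2}. ((\<lambda>s. p s * u' s) has_real_derivative w t) (at t)) \<and>
      (\<forall>t\<in>{T1<..<T2}.
        - w t + q t * u t = a * m t * max (u t) 0 - b * n t * max (- u t) 0) \<and>
      u' T1 = 0 \<and> u' T2 = 0)"

(* Solutions live on [T1,T2]; values of u outside this interval are irrelevant. *)
definition nontrivial_solution_zeros ::
  "real \<Rightarrow> real \<Rightarrow> (real \<Rightarrow> real) \<Rightarrow> (real \<Rightarrow> real) \<Rightarrow> (real \<Rightarrow> real) \<Rightarrow> (real \<Rightarrow> real)
    \<Rightarrow> nat \<Rightarrow> real \<Rightarrow> real \<Rightarrow> (real \<Rightarrow> real) \<Rightarrow> bool" where
  "nontrivial_solution_zeros T1 T2 p q m n k a b u \<longleftrightarrow>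
    neumann_solution T1 T2 p q m n a b u \<and>
    (\<exists>t\<in>{T1..T2}. u t \<noteq> 0) \<and>
    finite {t \<in> {T1<..<T2}. u t = 0} \<and>
    card {t \<in> {T1<..<T2}. u t = 0} = k"

definition C_gt ::
  "real \<Rightarrow> real \<Rightarrow> (real \<Rightarrow> real) \<Rightarrow> (real \<Rightarrow> real) \<Rightarrow> (real \<Rightarrow> real) \<Rightarrow> (real \<Rightarrow> real)
    \<Rightarrow> nat \<Rightarrow> (real \<times> real) set" where
  "C_gt T1 T2 p q m n k =
    {(a, b). \<exists>u. nontrivial_solution_zeros T1 T2 p q m n k a b u \<and> u T2 > 0}"

definition C_lt ::
  "real \<Rightarrow> real \<Rightarrow> (real \<Rightarrow> real) \<Rightarrow> (real \<Rightarrow> real) \<Rightarrow> (real \<Rightarrow> real) \<Rightarrow> (real \<Rightarrow> real)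
    \<Rightarrow> nat \<Rightarrow> (real \<times> real) set" where
  "C_lt T1 T2 p q m n k =
    {(a, b). \<exists>u. nontrivial_solution_zeros T1 T2 p q m n k a b u \<and> u T2 < 0}"

datatype sign = Plus | Minus

fun half_line :: "sign \<Rightarrow> real set" where
  "half_line Plus = {0..}"
| "half_line Minus = {..0}"

definition strictly_below ::
  "(real \<times> real) set \<Rightarrow> (real \<times> real) set \<Rightarrow> (real \<times> real) set \<Rightarrow> bool" where
  "strictly_below Q C C' \<longleftrightarrow>
    (\<forall>a b b'. (a, b) \<in> C \<inter> Q \<longrightarrow> (a, b') \<in> C' \<inter> Q \<longrightarrow> b < b')"

definition strictly_above ::
  "(real \<times> real) set \<Rightarrow> (real \<times> real) set \<Rightarrow> (real \<times> real) set \<Rightarrow> bool" where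
  "strictly_above Q C C' \<longleftrightarrow>
    (\<forall>a b b'. (a, b) \<in> C \<inter> Q \<longrightarrow> (a, b') \<in> C' \<inter> Q \<longrightarrow> b > b')"

end

theory Submission
  imports Defs
begin

text \<open>
Write \<open>M = a m\<close>, \<open>N = b n\<close> and \<open>u = R sin \<theta>\<close>, \<open>p u' = R cos \<theta>\<close>. The angle crosses the multiples of
\<open>pi\<close> only upwards, so a solution with exactly \<open>k\<close> zeros is an angle running from \<open>i pi + pi / 2\<close> to
\<open>(i + k) pi + pi / 2\<close>, where \<open>i = 0\<close> or \<open>i = 1\<close> according to the sign of \<open>u(T1)\<close>.

From (ii) to (i): for the pair \<open>(a, b)\<close> both angles, started at \<open>pi / 2\<close> and at \<open>3 pi / 2\<close>, have advanced
by at least \<open>k pi\<close>, while for \<open>(0, 0)\<close> they cannot advance at all because \<open>q \<ge> 0\<close>. The intermediate value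
theorem along \<open>(r a, r b)\<close>, \<open>0 \<le> r \<le> 1\<close>, gives both solutions with \<open>k\<close> zeros.

From (i) to (ii): a solution with \<open>k\<close> zeros yields \<open>k + 1\<close> successive points at which \<open>M\<close> and \<open>N\<close> are
alternately positive. Two such chains, one starting with \<open>M\<close> and one starting with \<open>N\<close>, give a chain of
length \<open>k + 2\<close>, and then the angle for \<open>(r M, r N)\<close> makes at least \<open>k + 2\<close> half-turns once \<open>r\<close> is large.

The strict order follows from the monotonicity of the angle in \<open>\<bar>b\<bar>\<close>, which is obtained from a
comparison of Riccati equations, together with the interlacing of the two angles.
\<close>

section \<open>Scalar differential equations\<close>

lemma gronwall_exceptional:
  fixes f :: "real \<Rightarrow> real"
  assumes "finite S" "continuous_on {a..b} f"
    and deriv: "\<And>t. t \<in> {a<..<b} - S \<Longrightarrow> \<exists>d. (f has_real_derivative d) (at t) \<and> d \<le> K * f t"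
    and t: "t \<in> {a..b}"
  shows "f t \<le> f a * exp (K * (t - a))"
proof -
  define g where "g = (\<lambda>s. f s * exp (- K * (s - a)))"
  from deriv obtain d where
    d: "\<And>s. s \<in> {a<..<b} - S \<Longrightarrow> (f has_real_derivative d s) (at s) \<and> d s \<le> K * f s"
    by metis
  \<comment> \<open>Setting the integrand to 0 at the exceptional points makes it nonpositive
    everywhere.\<close>
  define e where "e = (\<lambda>s. if s \<in> {a<..<b} - S then (d s - K * f s) * exp (- K * (s - a)) else 0)"
  have "(e has_integral (g t - g a)) {a..t}"
  proof (rule fundamental_theorem_of_calculus_interior_strong[OF \<open>finite S\<close>])
    show "continuous_on {a..t} g"
      unfolding g_def using t
      by (intro continuous_intros continuous_on_subset[OF assms(2)]) auto
    fix s assume s: "s \<in> {a<..<t} - S"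
    with t have s': "s \<in> {a<..<b} - S" by auto
    have "(g has_real_derivative e s) (at s)"
      unfolding g_def e_def using s' d[OF s']
      by (auto intro!: derivative_eq_intros simp: algebra_simps)
    then show "(g has_vector_derivative e s) (at s)"
      by (simp add: has_real_derivative_iff_has_vector_derivative)
  qed (use t in auto)
  moreover have "e s \<le> 0" for s
    using d[of s] by (auto simp: e_def mult_le_0_iff)
  ultimately have "g t - g a \<le> 0"
    using has_integral_le[OF _ has_integral_0] by blast
  then have "f t * exp (- K * (t - a)) \<le> f a" by (simp add: g_def)
  then have "f t * exp (- K * (t - a)) * exp (K * (t - a)) \<le> f a * exp (K * (t - a))"
    by (intro mult_right_mono) auto
  then show ?thesis by (simp add: mult.assoc flip: exp_add)
qed

text \<open>Squaring removes the corner of the positive part at 0. Applied to \<open>f - g\<close>,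
  the result is a differentiable measure of how far \<open>f\<close> exceeds \<open>g\<close>, to
  which Gronwall applies.\<close>

lemma has_real_derivative_square_pos_part:
  "((\<lambda>x::real. (max x 0)\<^sup>2) has_real_derivative 2 * max x 0) (at x)"
proof -
  consider "x > 0" | "x < 0" | "x = 0" by linarith
  then show ?thesis
  proof cases
    case 1
    have "((\<lambda>x::real. x\<^sup>2) has_real_derivative 2 * max x 0) (at x)"
      using 1 by (auto intro!: derivative_eq_intros)
    then show ?thesis
      by (rule DERIV_cong_ev[THEN iffD1, rotated -1])
        (use 1 in \<open>auto intro: eventually_mono[OF eventually_nhds_in_open[of "{0<..}"]]\<close>)
  next
    case 2
    have "((\<lambda>x::real. 0) has_real_derivative 2 * max x 0) (at x)"
      using 2 by (auto intro!: derivative_eq_intros)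
    then show ?thesis
      by (rule DERIV_cong_ev[THEN iffD1, rotated -1])
        (use 2 in \<open>auto intro: eventually_mono[OF eventually_nhds_in_open[of "{..<0}"]]\<close>)
  next
    case 3
    have "((\<lambda>h. (max h 0)\<^sup>2 / h) \<longlongrightarrow> (0::real)) (at 0)"
    proof (rule Lim_null_comparison[where g = abs])
      have "\<bar>(max h 0)\<^sup>2 / h\<bar> \<le> \<bar>h\<bar>" for h :: real
        by (cases "h > 0") (auto simp: max_def power2_eq_square)
      then show "\<forall>\<^sub>F h in at (0::real). norm ((max h 0)\<^sup>2 / h) \<le> \<bar>h\<bar>" by auto
    qed (auto intro!: tendsto_eq_intros)
    then show ?thesis by (simp add: 3 DERIV_def)
  qed
qed

text \<open>The squared positive part of \<open>f - g\<close> vanishes at \<open>a\<close> and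
  satisfies a Gronwall inequality with constant \<open>2 * L\<close>: where \<open>f\<close> exceeds
  \<open>g\<close>, the Lipschitz bound controls the difference of the derivatives.\<close>

lemma comparison_weak:
  fixes f g :: "real \<Rightarrow> real"
  assumes "finite S" and cont: "continuous_on {a..b} f" "continuous_on {a..b} g"
    and lip: "\<And>t x y. t \<in> {a<..<b} \<Longrightarrow> \<bar>F t x - F t y\<bar> \<le> L * \<bar>x - y\<bar>"
    and sub: "\<And>t. t \<in> {a<..<b} - S \<Longrightarrow> \<exists>d. (f has_real_derivative d) (at t) \<and> d \<le> F t (f t)"
    and super: "\<And>t. t \<in> {a<..<b} - S \<Longrightarrow> \<exists>d. (g has_real_derivative d) (at t) \<and> F t (g t) \<le> d"
    and le: "f a \<le> g a" and t: "t \<in> {a..b}"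
  shows "f t \<le> g t"
proof -
  define E where "E = (\<lambda>t. (max (f t - g t) 0)\<^sup>2)"
  have "E t \<le> E a * exp (2 * L * (t - a))"
  proof (rule gronwall_exceptional[OF \<open>finite S\<close> _ _ t])
    show "continuous_on {a..b} E"
      unfolding E_def by (intro continuous_intros cont)
    fix s assume s: "s \<in> {a<..<b} - S"
    from sub[OF s] super[OF s] obtain d e where
      de: "(f has_real_derivative d) (at s)" "d \<le> F s (f s)"
        "(g has_real_derivative e) (at s)" "F s (g s) \<le> e" by auto
    have "(E has_real_derivative 2 * max (f s - g s) 0 * (d - e)) (at s)"
      unfolding E_def
      using DERIV_chain2[OF has_real_derivative_square_pos_part DERIV_diff[OF de(1,3)]] .
    moreover have "2 * max (f s - g s) 0 * (d - e) \<le> 2 * L * E s"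
    proof (cases "f s \<le> g s")
      case False
      have "d - e \<le> F s (f s) - F s (g s)" using de by linarith
      also have "\<dots> \<le> L * (f s - g s)" using lip[of s "f s" "g s"] s False by auto
      finally have "(f s - g s) * (d - e) \<le> (f s - g s) * (L * (f s - g s))"
        using False by (intro mult_left_mono) auto
      then show ?thesis using False by (simp add: E_def power2_eq_square mult_ac max_def)
    qed (simp add: E_def)
    ultimately show "\<exists>d. (E has_real_derivative d) (at s) \<and> d \<le> 2 * L * E s" by blast
  qed
  then have "E t \<le> 0" using le by (simp add: E_def)
  then show ?thesis by (simp add: E_def)
qed

text \<open>Once \<open>f \<le> g\<close> is known, the Lipschitz bound gives
  \<open>(f - g)' \<le> - L * (f - g)\<close>. A negative initial gap therefore shrinks at most
  exponentially and never closes.\<close>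

lemma comparison_strict:
  fixes f g :: "real \<Rightarrow> real"
  assumes cont: "continuous_on {a..b} f" "continuous_on {a..b} g"
    and lip: "\<And>t x y. t \<in> {a<..<b} \<Longrightarrow> \<bar>F t x - F t y\<bar> \<le> L * \<bar>x - y\<bar>"
    and sub: "\<And>t. t \<in> {a<..<b} \<Longrightarrow> \<exists>d. (f has_real_derivative d) (at t) \<and> d \<le> F t (f t)"
    and super: "\<And>t. t \<in> {a<..<b} \<Longrightarrow> \<exists>d. (g has_real_derivative d) (at t) \<and> F t (g t) \<le> d"
    and less: "f a < g a" and t: "t \<in> {a..b}"
  shows "f t < g t"
proof -
  have "f t - g t \<le> (f a - g a) * exp (- L * (t - a))"
  proof (rule gronwall_exceptional[OF finite.emptyI _ _ t])
    show "continuous_on {a..b} (\<lambda>t. f t - g t)" by (intro continuous_intros cont)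
    fix s assume s: "s \<in> {a<..<b} - {}"
    with sub[of s] super[of s] obtain d e where
      de: "(f has_real_derivative d) (at s)" "d \<le> F s (f s)"
        "(g has_real_derivative e) (at s)" "F s (g s) \<le> e" by auto
    have "f s \<le> g s"
      by (rule comparison_weak[OF finite.emptyI cont lip sub super]) (use less s in auto)
    then have "\<bar>F s (f s) - F s (g s)\<bar> \<le> - L * (f s - g s)"
      using lip[of s "f s" "g s"] s by (auto simp: algebra_simps)
    with de have "d - e \<le> - L * (f s - g s)" by linarith
    then show "\<exists>d. ((\<lambda>t. f t - g t) has_real_derivative d) (at s) \<and> d \<le> - L * (f s - g s)"
      using DERIV_diff[OF de(1,3)] by blast
  qed
  also have "\<dots> < 0" using less by (simp add: mult_less_0_iff)
  finally show ?thesis by simp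
qed

text \<open>Picard iteration on the whole interval at once: in the unknown
  \<open>z t = exp (- 2 * L * t) * \<theta> t\<close> the integral operator contracts the supremum
  distance by the factor 1/2.\<close>

lemma ode_exists:
  fixes F :: "real \<Rightarrow> real \<Rightarrow> real"
  assumes "T1 \<le> T2" "L > 0"
    and cont: "\<And>\<theta>. continuous_on {T1..T2} \<theta> \<Longrightarrow> continuous_on {T1..T2} (\<lambda>t. F t (\<theta> t))"
    and lip: "\<And>t x y. t \<in> {T1..T2} \<Longrightarrow> \<bar>F t x - F t y\<bar> \<le> L * \<bar>x - y\<bar>"
  shows "\<exists>\<theta>. \<theta> T1 = c \<and>
    (\<forall>t\<in>{T1..T2}. (\<theta> has_real_derivative F t (\<theta> t)) (at t within {T1..T2}))"
proof -
  \<comment> \<open>Clamping the time to the interval extends functions to the whole line, so the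
    fixed point can be sought in the complete space of bounded continuous functions.\<close>
  define \<kappa> where "\<kappa> = (\<lambda>t. max T1 (min T2 t))"
  have \<kappa>: "\<kappa> t \<in> {T1..T2}" and \<kappa>_id: "t \<in> {T1..T2} \<Longrightarrow> \<kappa> t = t" for t
    using \<open>T1 \<le> T2\<close> by (auto simp: \<kappa>_def)
  have cont_\<kappa>: "continuous_on UNIV \<kappa>" unfolding \<kappa>_def by (intro continuous_intros)
  define I where "I = (\<lambda>z t. c + integral {T1..t} (\<lambda>s. F s (exp (2 * L * s) * z s)))"
  have cF: "continuous_on {T1..T2} (\<lambda>s. F s (exp (2 * L * s) * z s))"
    if "continuous_on {T1..T2} z" for z
    by (intro cont continuous_intros that)
  have I_deriv: "(I z has_real_derivative F t (exp (2 * L * t) * z t)) (at t within {T1..T2})"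
    if "continuous_on {T1..T2} z" "t \<in> {T1..T2}" for z t
    unfolding I_def
    using DERIV_add[OF DERIV_const integral_has_real_derivative[OF cF[OF that(1)] that(2)]] by simp
  have cI: "continuous_on {T1..T2} (I z)" if "continuous_on {T1..T2} z" for z
    using I_deriv[OF that] by (meson DERIV_continuous continuous_on_eq_continuous_within)
  define G where "G = (\<lambda>z t. exp (- 2 * L * \<kappa> t) * I z (\<kappa> t))"
  have G_bcontfun: "G z \<in> bcontfun" if z: "continuous_on {T1..T2} z" for z
  proof -
    have c: "continuous_on {T1..T2} (\<lambda>t. exp (- 2 * L * t) * I z t)"
      by (intro continuous_intros cI z)
    have "continuous_on UNIV (G z)"
      unfolding G_def by (rule continuous_on_compose2[OF c cont_\<kappa>]) (use \<kappa> in auto)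
    moreover have "bounded (range (G z))"
      by (rule bounded_subset[OF compact_imp_bounded[OF compact_continuous_image[OF c compact_Icc]]])
        (use \<kappa> in \<open>auto simp: G_def\<close>)
    ultimately show ?thesis by (simp add: bcontfun_def)
  qed
  define A where "A = (\<lambda>z :: real \<Rightarrow>\<^sub>C real. Bcontfun (G z))"
  have A: "apply_bcontfun (A z) = G z" for z
    unfolding A_def by (rule Bcontfun_inverse) (intro G_bcontfun continuous_on_apply_bcontfun)
  have "dist (A z) (A y) \<le> 1 / 2 * dist z y" for z y
  proof (rule dist_bound)
    fix t
    let ?t = "\<kappa> t" and ?d = "dist z y"
    have t: "?t \<in> {T1..T2}" by (rule \<kappa>)
    define D where "D = (\<lambda>s. F s (exp (2 * L * s) * z s) - F s (exp (2 * L * s) * y s))"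
    have int: "(\<lambda>s. F s (exp (2 * L * s) * z s)) integrable_on {T1..?t}"
      for z :: "real \<Rightarrow>\<^sub>C real"
      by (intro integrable_continuous_real continuous_on_subset[OF cF]) (use t in auto)
    \<comment> \<open>The 2 in the exponent is the source of the contraction constant:
      \<open>L * exp (2 * L * s)\<close> has the primitive
      \<open>exp (2 * L * s) / 2\<close>.\<close>
    have "((\<lambda>s. L * exp (2 * L * s) * ?d) has_integral
        (exp (2 * L * ?t) / 2 * ?d - exp (2 * L * T1) / 2 * ?d)) {T1..?t}"
      using t \<open>L > 0\<close>
      by (intro fundamental_theorem_of_calculus)
        (auto intro!: derivative_eq_intros
          simp flip: has_real_derivative_iff_has_vector_derivative)
    moreover have "norm (D s) \<le> L * exp (2 * L * s) * ?d" if "s \<in> {T1..?t}" for s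
    proof -
      have "norm (D s) \<le> L * \<bar>exp (2 * L * s) * z s - exp (2 * L * s) * y s\<bar>"
        unfolding D_def using lip[of s] that t by auto
      also have "\<dots> = L * exp (2 * L * s) * dist (z s) (y s)"
        by (simp add: dist_real_def abs_mult flip: right_diff_distrib)
      also have "\<dots> \<le> L * exp (2 * L * s) * ?d"
        using \<open>L > 0\<close> by (intro mult_left_mono dist_bounded) auto
      finally show ?thesis .
    qed
    moreover have "D integrable_on {T1..?t}"
      unfolding D_def by (intro integrable_diff int)
    ultimately have "norm (integral {T1..?t} D) \<le>
        exp (2 * L * ?t) / 2 * ?d - exp (2 * L * T1) / 2 * ?d"
      by (metis integral_norm_bound_integral has_integral_integrable integral_unique)
    also have "\<dots> \<le> exp (2 * L * ?t) / 2 * ?d" by simp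
    finally have *: "\<bar>integral {T1..?t} D\<bar> \<le> exp (2 * L * ?t) / 2 * ?d" by simp
    have "dist (A z t) (A y t) = exp (- 2 * L * ?t) * \<bar>integral {T1..?t} D\<bar>"
      unfolding A G_def I_def D_def dist_real_def integral_diff[OF int int]
      by (simp add: abs_mult flip: right_diff_distrib)
    also have "\<dots> \<le> exp (- 2 * L * ?t) * (exp (2 * L * ?t) / 2 * ?d)"
      using * by (intro mult_left_mono) auto
    also have "\<dots> = 1 / 2 * ?d" by (simp add: exp_minus)
    finally show "dist (A z t) (A y t) \<le> 1 / 2 * ?d" .
  qed
  then have "\<exists>!z. A z = z" by (intro banach_fix_type[of "1/2"]) auto
  then obtain z where z: "A z = z" by blast
  let ?\<theta> = "I z"
  have eq: "exp (2 * L * t) * z t = ?\<theta> t" if "t \<in> {T1..T2}" for t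
  proof -
    have "z t = G z t" using A[of z] z by simp
    then show ?thesis by (simp add: G_def \<kappa>_id[OF that] exp_minus)
  qed
  have "(?\<theta> has_real_derivative F t (?\<theta> t)) (at t within {T1..T2})" if "t \<in> {T1..T2}" for t
    using I_deriv[OF continuous_on_apply_bcontfun that, of z] eq[OF that] by simp
  then show ?thesis by (intro exI[of _ ?\<theta>]) (auto simp: I_def)
qed

lemma continuous_on_Icc_bound:
  fixes f :: "real \<Rightarrow> real"
  assumes "continuous_on {a..b} f"
  obtains B where "B \<ge> 0" "\<And>t. t \<in> {a..b} \<Longrightarrow> \<bar>f t\<bar> \<le> B"
proof -
  have "bounded (f ` {a..b})"
    using assms compact_Icc compact_continuous_image compact_imp_bounded by blast
  then obtain B where "\<forall>t\<in>{a..b}. \<bar>f t\<bar> \<le> B" by (auto simp: bounded_iff)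
  then show thesis by (intro that[of "max B 0"]) (auto simp: le_max_iff_disj)
qed

section \<open>The Pruefer angle\<close>

locale prufer =
  fixes T1 T2 :: real and P q :: "real \<Rightarrow> real"
  assumes T1_less_T2: "T1 < T2"
    and cont_P: "continuous_on {T1..T2} P" and cont_q: "continuous_on {T1..T2} q"
    and P_pos: "t \<in> {T1..T2} \<Longrightarrow> P t > 0" and q_nonneg: "t \<in> {T1..T2} \<Longrightarrow> q t \<ge> 0"
begin

text \<open>\<open>P\<close> stands for \<open>1 / p\<close>, and \<open>force M N t u\<close> is the value of \<open>(p u')'\<close> that the equation prescribes.\<close>

definition force :: "(real \<Rightarrow> real) \<Rightarrow> (real \<Rightarrow> real) \<Rightarrow> real \<Rightarrow> real \<Rightarrow> real" where
  "force M N t x = q t * x - M t * max x 0 + N t * max (- x) 0"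

text \<open>This is \<open>(u' v - u v') / R^2\<close>, the derivative of the polar angle. Positive
  homogeneity of \<open>force\<close> cancels the amplitude, so the angle obeys a scalar equation of
  its own.\<close>

definition speed :: "(real \<Rightarrow> real) \<Rightarrow> (real \<Rightarrow> real) \<Rightarrow> real \<Rightarrow> real \<Rightarrow> real" where
  "speed M N t x = P t * (cos x)\<^sup>2 - sin x * force M N t (sin x)"

definition prufer_angle :: "(real \<Rightarrow> real) \<Rightarrow> (real \<Rightarrow> real) \<Rightarrow> (real \<Rightarrow> real) \<Rightarrow> bool" where
  "prufer_angle M N \<theta> \<longleftrightarrow>
    (\<forall>t\<in>{T1..T2}. (\<theta> has_real_derivative speed M N t (\<theta> t)) (at t within {T1..T2}))"

lemma speed_alt:
  "speed M N t x = P t * (cos x)\<^sup>2 - q t * (sin x)\<^sup>2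
     + M t * (max (sin x) 0)\<^sup>2 + N t * (max (- sin x) 0)\<^sup>2"
  by (auto simp: speed_def force_def power2_eq_square max_def algebra_simps)

text \<open>Every summand is a bounded coefficient times the square of a 1-Lipschitz function with
  values in [-1, 1], and such a square is 2-Lipschitz. The final 1 in the constant keeps it
  positive.\<close>

lemma speed_lipschitz:
  assumes "continuous_on {T1..T2} M" "continuous_on {T1..T2} N"
  obtains L where "L > 0"
    "\<And>t x y. t \<in> {T1..T2} \<Longrightarrow> \<bar>speed M N t x - speed M N t y\<bar> \<le> L * \<bar>x - y\<bar>"
proof -
  obtain BP Bq BM BN where B: "BP \<ge> 0" "Bq \<ge> 0" "BM \<ge> 0" "BN \<ge> 0"
    "\<And>t. t \<in> {T1..T2} \<Longrightarrow> \<bar>P t\<bar> \<le> BP" "\<And>t. t \<in> {T1..T2} \<Longrightarrow> \<bar>q t\<bar> \<le> Bq"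
    "\<And>t. t \<in> {T1..T2} \<Longrightarrow> \<bar>M t\<bar> \<le> BM" "\<And>t. t \<in> {T1..T2} \<Longrightarrow> \<bar>N t\<bar> \<le> BN"
    by (metis continuous_on_Icc_bound assms cont_P cont_q)
  have sq: "\<bar>a\<^sup>2 - b\<^sup>2\<bar> \<le> 2 * d" if "\<bar>a\<bar> \<le> 1" "\<bar>b\<bar> \<le> 1" "\<bar>a - b\<bar> \<le> d" for a b d :: real
  proof -
    have "\<bar>a\<^sup>2 - b\<^sup>2\<bar> = \<bar>a + b\<bar> * \<bar>a - b\<bar>"
      by (simp add: power2_eq_square square_diff_square_factored abs_mult)
    also have "\<dots> \<le> 2 * d" using that by (intro mult_mono) auto
    finally show ?thesis .
  qed
  have tri: "\<bar>- w * r - x * r + y * s + z * t\<bar> \<le> \<bar>w * r\<bar> + \<bar>x * r\<bar> + \<bar>y * s\<bar> + \<bar>z * t\<bar>"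
    for w x y z r s t :: real by (simp add: abs_le_iff) linarith
  have pm: "\<bar>w * r\<bar> \<le> W * D" if "\<bar>w\<bar> \<le> W" "\<bar>r\<bar> \<le> D" for w r W D :: real
    unfolding abs_mult using that by (intro mult_mono) auto
  show thesis
  proof (rule that[of "2 * BP + 2 * Bq + 2 * BM + 2 * BN + 1"])
    fix t x y :: real assume t: "t \<in> {T1..T2}"
    have "\<bar>sin x - sin y\<bar> = 2 * \<bar>sin ((x - y) / 2)\<bar> * \<bar>cos ((x + y) / 2)\<bar>"
      by (simp add: sin_diff_sin abs_mult)
    also have "\<dots> \<le> 2 * \<bar>(x - y) / 2\<bar> * 1"
      by (intro mult_mono mult_left_mono abs_sin_x_le_abs_x) auto
    finally have s: "\<bar>sin x - sin y\<bar> \<le> \<bar>x - y\<bar>" by simp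
    have b: "\<bar>sin x\<bar> \<le> 1" "\<bar>sin y\<bar> \<le> 1" by auto
    let ?d1 = "(sin x)\<^sup>2 - (sin y)\<^sup>2"
    let ?d2 = "(max (sin x) 0)\<^sup>2 - (max (sin y) 0)\<^sup>2"
    let ?d3 = "(max (- sin x) 0)\<^sup>2 - (max (- sin y) 0)\<^sup>2"
    have d: "\<bar>?d1\<bar> \<le> 2 * \<bar>x - y\<bar>" "\<bar>?d2\<bar> \<le> 2 * \<bar>x - y\<bar>" "\<bar>?d3\<bar> \<le> 2 * \<bar>x - y\<bar>"
      by (rule sq; use s b in linarith)+
    have "speed M N t x - speed M N t y = - P t * ?d1 - q t * ?d1 + M t * ?d2 + N t * ?d3"
      by (simp add: speed_alt cos_squared_eq algebra_simps)
    also have "\<bar>\<dots>\<bar> \<le> \<bar>P t * ?d1\<bar> + \<bar>q t * ?d1\<bar> + \<bar>M t * ?d2\<bar> + \<bar>N t * ?d3\<bar>" by (rule tri)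
    also have "\<dots> \<le> BP * (2 * \<bar>x - y\<bar>) + Bq * (2 * \<bar>x - y\<bar>) + BM * (2 * \<bar>x - y\<bar>)
        + BN * (2 * \<bar>x - y\<bar>)"
      by (intro add_mono pm B(5-8)[OF t] d)
    also have "\<dots> \<le> (2 * BP + 2 * Bq + 2 * BM + 2 * BN + 1) * \<bar>x - y\<bar>"
      by (simp add: algebra_simps)
    finally show "\<bar>speed M N t x - speed M N t y\<bar>
      \<le> (2 * BP + 2 * Bq + 2 * BM + 2 * BN + 1) * \<bar>x - y\<bar>" .
  qed (use B in auto)
qed

lemma speed_weight_diff:
  "\<bar>speed M N t x - speed M' N' t x\<bar> \<le> \<bar>M t - M' t\<bar> + \<bar>N t - N' t\<bar>"
proof -
  have b: "\<bar>max (sin x) 0\<bar> \<le> 1" "\<bar>max (- sin x) 0\<bar> \<le> 1" by (auto simp: abs_le_iff)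
  have sq: "\<bar>(max (sin x) 0)\<^sup>2\<bar> \<le> 1" "\<bar>(max (- sin x) 0)\<^sup>2\<bar> \<le> 1"
    using b by (auto simp: abs_square_le_1)
  have "speed M N t x - speed M' N' t x
      = (M t - M' t) * (max (sin x) 0)\<^sup>2 + (N t - N' t) * (max (- sin x) 0)\<^sup>2"
    by (simp add: speed_alt algebra_simps)
  also have "\<bar>\<dots>\<bar> \<le> \<bar>M t - M' t\<bar> * 1 + \<bar>N t - N' t\<bar> * 1"
    by (rule order_trans[OF abs_triangle_ineq], unfold abs_mult,
        intro add_mono mult_left_mono) (use sq in \<open>auto simp: abs_mult\<close>)
  finally show ?thesis by simp
qed

lemma prufer_angle_exists:
  assumes "continuous_on {T1..T2} M" "continuous_on {T1..T2} N"
  obtains \<theta> where "prufer_angle M N \<theta>" "\<theta> T1 = c"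
proof -
  obtain L where "L > 0"
    "\<And>t x y. t \<in> {T1..T2} \<Longrightarrow> \<bar>speed M N t x - speed M N t y\<bar> \<le> L * \<bar>x - y\<bar>"
    using speed_lipschitz[OF assms] by metis
  moreover have "continuous_on {T1..T2} (\<lambda>t. speed M N t (\<theta> t))"
    if "continuous_on {T1..T2} \<theta>" for \<theta>
    unfolding speed_alt by (intro continuous_intros cont_P cont_q assms that)
  ultimately have "\<exists>\<theta>. \<theta> T1 = c \<and>
      (\<forall>t\<in>{T1..T2}. (\<theta> has_real_derivative speed M N t (\<theta> t)) (at t within {T1..T2}))"
    using T1_less_T2 by (intro ode_exists) auto
  then show thesis using that by (auto simp: prufer_angle_def)
qed

text \<open>At a zero of \<open>u\<close> the weights drop out and \<open>P t > 0\<close> remains,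
  which is why multiples of pi are crossed upwards only.\<close>

lemma speed_multiple_pi:
  assumes "sin x = 0"
  shows "speed M N t x = P t"
  using assms by (simp add: speed_alt cos_squared_eq)

lemma speed_add_2pi: "speed M N t (x + 2 * pi) = speed M N t x"
  by (simp add: speed_alt)

context
  fixes M N \<theta>
  assumes \<theta>: "prufer_angle M N \<theta>"
begin

lemma prufer_angle_deriv:
  assumes "t \<in> {T1<..<T2}"
  shows "(\<theta> has_real_derivative speed M N t (\<theta> t)) (at t)"
proof -
  have "(\<theta> has_real_derivative speed M N t (\<theta> t)) (at t within {T1..T2})"
    using \<theta> assms by (auto simp: prufer_angle_def)
  then show ?thesis using assms at_within_interior[of t "{T1..T2}"] by simp
qed

lemma prufer_angle_continuous:
  assumes "T1 \<le> a" "b \<le> T2"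
  shows "continuous_on {a..b} \<theta>"
proof -
  have "continuous_on {T1..T2} \<theta>"
    using \<theta> unfolding prufer_angle_def
    by (meson DERIV_continuous continuous_on_eq_continuous_within)
  then show ?thesis by (rule continuous_on_subset) (use assms in auto)
qed

lemma prufer_angle_IVT:
  assumes "T1 \<le> a" "a \<le> b" "b \<le> T2" "\<theta> a \<le> y" "y \<le> \<theta> b"
  obtains t where "a \<le> t" "t \<le> b" "\<theta> t = y"
  using IVT'[of \<theta> a y b] prufer_angle_continuous assms by metis

lemma prufer_angle_shift: "prufer_angle M N (\<lambda>t. \<theta> t + 2 * pi)"
  using \<theta> unfolding prufer_angle_def
  by (auto intro!: derivative_eq_intros simp: speed_add_2pi)

context
  assumes cont: "continuous_on {T1..T2} M" "continuous_on {T1..T2} N"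
begin

lemma prufer_angle_super:
  assumes "T1 \<le> a" "b \<le> T2" "continuous_on {a..b} f" "finite S"
    and "\<And>t. t \<in> {a<..<b} - S \<Longrightarrow> \<exists>d. (f has_real_derivative d) (at t) \<and> d \<le> speed M N t (f t)"
    and "f a \<le> \<theta> a" "t \<in> {a..b}"
  shows "f t \<le> \<theta> t"
proof -
  obtain L where "\<And>t x y. t \<in> {T1..T2} \<Longrightarrow> \<bar>speed M N t x - speed M N t y\<bar> \<le> L * \<bar>x - y\<bar>"
    using speed_lipschitz[OF cont] by metis
  moreover have "\<exists>d. (\<theta> has_real_derivative d) (at t) \<and> speed M N t (\<theta> t) \<le> d"
    if "t \<in> {a<..<b} - S" for t
    using prufer_angle_deriv[of t] that assms by auto
  ultimately show ?thesis
    using assms(1,2)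
    by (intro comparison_weak[of S a b f \<theta> "speed M N" L t] assms prufer_angle_continuous) auto
qed

text \<open>A constant multiple of pi is a subsolution: its derivative 0 lies below the prescribed
  speed \<open>P\<close>.\<close>

lemma prufer_angle_above:
  assumes "T1 \<le> a" "a \<le> t" "t \<le> T2" "sin c = 0" "c \<le> \<theta> a"
  shows "c \<le> \<theta> t"
proof (rule prufer_angle_super[of a t "\<lambda>_. c" "{}"])
  fix s assume "s \<in> {a<..<t} - {}"
  then have "P s > 0" using assms by (intro P_pos) auto
  then show "\<exists>d. ((\<lambda>_. c) has_real_derivative d) (at s) \<and> d \<le> speed M N s c"
    by (intro exI[of _ 0]) (simp add: speed_multiple_pi assms)
qed (use assms in auto)

text \<open>Being at the level \<open>c\<close> at the later time \<open>t\<close> is impossible: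
  the positive derivative there would put the angle below \<open>c\<close> just before
  \<open>t\<close>.\<close>

lemma prufer_angle_above_strict:
  assumes "T1 \<le> a" "a < t" "t \<le> T2" "sin c = 0" "c \<le> \<theta> a"
  shows "c < \<theta> t"
proof (rule ccontr)
  assume "\<not> c < \<theta> t"
  with prufer_angle_above[of a t c] assms have eq: "\<theta> t = c" by auto
  have t: "t \<in> {T1..T2}" using assms by auto
  have "(\<theta> has_real_derivative P t) (at t within {T1..T2})"
    using \<theta> t eq speed_multiple_pi[OF \<open>sin c = 0\<close>, of M N t] unfolding prufer_angle_def by metis
  from has_real_derivative_pos_inc_left[OF this P_pos[OF t]]
  obtain d where d: "d > 0" "\<And>h. h > 0 \<Longrightarrow> t - h \<in> {T1..T2} \<Longrightarrow> h < d \<Longrightarrow> \<theta> (t - h) < \<theta> t"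
    by auto
  define h where "h = min (d / 2) (t - a)"
  have "h > 0" "h < d" "h \<le> t - a" using d(1) assms by (auto simp: h_def)
  then have "\<theta> (t - h) < c" using d(2)[of h] assms eq by auto
  moreover have "c \<le> \<theta> (t - h)"
    by (rule prufer_angle_above[of a]) (use assms \<open>h > 0\<close> \<open>h \<le> t - a\<close> in auto)
  ultimately show False by simp
qed

end

end

lemma prufer_angle_mono:
  assumes "prufer_angle M N \<theta>" "prufer_angle M N \<phi>"
    and "continuous_on {T1..T2} M" "continuous_on {T1..T2} N"
    and "\<theta> T1 \<le> \<phi> T1" "t \<in> {T1..T2}"
  shows "\<theta> t \<le> \<phi> t"
proof (rule prufer_angle_super[OF assms(2-4), of T1 T2 \<theta> "{}"])
  show "continuous_on {T1..T2} \<theta>" by (rule prufer_angle_continuous[OF assms(1)]) auto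
  fix s assume "s \<in> {T1<..<T2} - {}"
  then show "\<exists>d. (\<theta> has_real_derivative d) (at s) \<and> d \<le> speed M N s (\<theta> s)"
    using prufer_angle_deriv[OF assms(1), of s] by auto
qed (use assms in auto)

lemma prufer_angle_strict_mono:
  assumes sol: "prufer_angle M N \<theta>" "prufer_angle M N \<phi>"
    and cont: "continuous_on {T1..T2} M" "continuous_on {T1..T2} N"
    and "\<theta> T1 < \<phi> T1" "t \<in> {T1..T2}"
  shows "\<theta> t < \<phi> t"
proof -
  obtain L where L:
    "\<And>t x y. t \<in> {T1..T2} \<Longrightarrow> \<bar>speed M N t x - speed M N t y\<bar> \<le> L * \<bar>x - y\<bar>"
    using speed_lipschitz[OF cont] by metis
  show ?thesis
  proof (rule comparison_strict[of T1 T2 \<theta> \<phi> "speed M N" L])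
    show "continuous_on {T1..T2} \<theta>" "continuous_on {T1..T2} \<phi>"
      by (rule prufer_angle_continuous[OF sol(1)] prufer_angle_continuous[OF sol(2)]; simp)+
    show "\<exists>d. (\<theta> has_real_derivative d) (at s) \<and> d \<le> speed M N s (\<theta> s)"
      "\<exists>d. (\<phi> has_real_derivative d) (at s) \<and> speed M N s (\<phi> s) \<le> d"
      if "s \<in> {T1<..<T2}" for s
      using prufer_angle_deriv[OF sol(1) that] prufer_angle_deriv[OF sol(2) that] by blast+
  qed (use assms L in auto)
qed

lemma sin_nat_pi: "sin (real j * pi) = 0"
  by (simp add: sin_npi)

text \<open>The angle maps the zeros bijectively onto the multiples of pi with indices from
  \<open>i + 1\<close> to \<open>i + k\<close>: none is met twice, and each lies strictly between
  the two end values.\<close>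

lemma prufer_angle_zeros:
  assumes \<theta>: "prufer_angle M N \<theta>"
    and cont: "continuous_on {T1..T2} M" "continuous_on {T1..T2} N"
    and ends: "\<theta> T1 = real i * pi + pi / 2" "\<theta> T2 = real (i + k) * pi + pi / 2"
  shows "finite {t \<in> {T1<..<T2}. sin (\<theta> t) = 0}"
    and "card {t \<in> {T1<..<T2}. sin (\<theta> t) = 0} = k"
proof -
  let ?Z = "{t \<in> {T1<..<T2}. sin (\<theta> t) = 0}" and ?J = "(\<lambda>j. real j * pi) ` {i+1..i+k}"
  note above = prufer_angle_above[OF \<theta> cont]
  note above_strict = prufer_angle_above_strict[OF \<theta> cont]
  have inj: "inj_on \<theta> ?Z"
  proof (rule linorder_inj_onI)
    fix x y assume "x < y" "x \<in> ?Z" "y \<in> ?Z"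
    then show "\<theta> x \<noteq> \<theta> y" using above_strict[of x y "\<theta> x"] by auto
  qed auto
  have sub: "\<theta> ` ?Z \<subseteq> ?J"
  proof
    fix y assume "y \<in> \<theta> ` ?Z"
    then obtain t where t: "t \<in> {T1<..<T2}" "sin (\<theta> t) = 0" "y = \<theta> t" by auto
    then obtain j :: int where j: "\<theta> t = of_int j * pi" by (auto simp: sin_zero_iff_int2)
    have "real i * pi < \<theta> t"
      using above_strict[of T1 t "real i * pi"] t ends by (auto simp: sin_nat_pi)
    then have "int i < j" unfolding j by simp
    moreover have "\<theta> t < real (i + k + 1) * pi"
    proof (rule ccontr)
      assume "\<not> \<theta> t < real (i + k + 1) * pi"
      then have "real (i + k + 1) * pi \<le> \<theta> T2"
        using t sin_nat_pi[of "i + k + 1"] by (intro above[of t T2]) auto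
      then show False unfolding ends by (simp add: algebra_simps)
    qed
    then have "j < int (i + k + 1)"
      unfolding j by (simp only: mult_less_cancel_right_pos pi_gt_zero)
    ultimately have "y = real (nat j) * pi" "nat j \<in> {i+1..i+k}" using t j by auto
    then show "y \<in> ?J" by blast
  qed
  have sup: "?J \<subseteq> \<theta> ` ?Z"
  proof
    fix y assume "y \<in> ?J"
    then obtain j where j: "i + 1 \<le> j" "j \<le> i + k" "y = real j * pi" by auto
    have "\<theta> T1 < real (i + 1) * pi" by (simp add: ends algebra_simps)
    also have "\<dots> \<le> y" unfolding j using j(1) by (intro mult_right_mono) (auto simp del: of_nat_add)
    finally have 1: "\<theta> T1 < y" .
    have "y \<le> real (i + k) * pi"
      unfolding j using j(2) by (intro mult_right_mono) (auto simp del: of_nat_add)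
    also have "\<dots> < \<theta> T2" by (simp add: ends)
    finally have 2: "y < \<theta> T2" .
    obtain t where t: "T1 \<le> t" "t \<le> T2" "\<theta> t = y"
      using prufer_angle_IVT[OF \<theta>, of T1 T2 y] 1 2 T1_less_T2 by auto
    moreover from t 1 2 have "t \<noteq> T1" "t \<noteq> T2" by auto
    ultimately have "t \<in> ?Z" using j(3) by (auto simp: sin_nat_pi)
    with t show "y \<in> \<theta> ` ?Z" by auto
  qed
  have img: "\<theta> ` ?Z = ?J" using sub sup by blast
  show "finite ?Z" by (rule finite_imageD[OF _ inj]) (unfold img, simp)
  have "card ?Z = card ?J" using card_image[OF inj] img by metis
  also have "\<dots> = k" by (subst card_image) (auto simp: inj_on_def)
  finally show "card ?Z = k" .
qed

text \<open>Planar form of the equation, with \<open>v = p u'\<close>.\<close>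

definition phase_solution :: "(real \<Rightarrow> real) \<Rightarrow> (real \<Rightarrow> real) \<Rightarrow> (real \<Rightarrow> real) \<Rightarrow> (real \<Rightarrow> real) \<Rightarrow> bool"
  where "phase_solution M N u v \<longleftrightarrow>
    continuous_on {T1..T2} u \<and> continuous_on {T1..T2} v \<and>
    (\<forall>t\<in>{T1<..<T2}. (u has_real_derivative P t * v t) (at t) \<and>
                    (v has_real_derivative force M N t (u t)) (at t))"

lemma force_scale: "R > 0 \<Longrightarrow> force M N t (R * x) = R * force M N t x"
  by (auto simp: force_def max_def algebra_simps mult_le_0_iff zero_le_mult_iff)

lemma force_lipschitz:
  assumes "continuous_on {T1..T2} M" "continuous_on {T1..T2} N"
  obtains L where "L \<ge> 0"
    "\<And>t x y. t \<in> {T1..T2} \<Longrightarrow> \<bar>force M N t x - force M N t y\<bar> \<le> L * \<bar>x - y\<bar>"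
proof -
  obtain Bq BM BN where B: "Bq \<ge> 0" "BM \<ge> 0" "BN \<ge> 0"
    "\<And>t. t \<in> {T1..T2} \<Longrightarrow> \<bar>q t\<bar> \<le> Bq"
    "\<And>t. t \<in> {T1..T2} \<Longrightarrow> \<bar>M t\<bar> \<le> BM" "\<And>t. t \<in> {T1..T2} \<Longrightarrow> \<bar>N t\<bar> \<le> BN"
    by (metis continuous_on_Icc_bound assms cont_q)
  show thesis
  proof (rule that[of "Bq + BM + BN"])
    fix t x y :: real assume t: "t \<in> {T1..T2}"
    have "force M N t x - force M N t y
        = q t * (x - y) - M t * (max x 0 - max y 0) + N t * (max (- x) 0 - max (- y) 0)"
      by (simp add: force_def algebra_simps)
    also have "\<bar>\<dots>\<bar> \<le> \<bar>q t * (x - y)\<bar> + \<bar>M t * (max x 0 - max y 0)\<bar>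
        + \<bar>N t * (max (- x) 0 - max (- y) 0)\<bar>" by linarith
    also have "\<dots> \<le> Bq * \<bar>x - y\<bar> + BM * \<bar>x - y\<bar> + BN * \<bar>x - y\<bar>"
      unfolding abs_mult by (intro add_mono mult_mono B t) auto
    finally show "\<bar>force M N t x - force M N t y\<bar> \<le> (Bq + BM + BN) * \<bar>x - y\<bar>"
      by (simp add: algebra_simps)
  qed (use B in auto)
qed

text \<open>Gronwall for the squared distance in the plane. Mixed products are absorbed through
  \<open>2 * \<bar>x\<bar> * \<bar>y\<bar> \<le> x^2 + y^2\<close>.\<close>

lemma phase_solution_unique:
  assumes cont: "continuous_on {T1..T2} M" "continuous_on {T1..T2} N"
    and sol: "phase_solution M N u v" "phase_solution M N x y"
    and init: "u T1 = x T1" "v T1 = y T1" and t: "t \<in> {T1..T2}"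
  shows "u t = x t \<and> v t = y t"
proof -
  obtain L where L: "L \<ge> 0"
    "\<And>t x y. t \<in> {T1..T2} \<Longrightarrow> \<bar>force M N t x - force M N t y\<bar> \<le> L * \<bar>x - y\<bar>"
    using force_lipschitz[OF cont] by metis
  obtain B where B: "B \<ge> 0" "\<And>t. t \<in> {T1..T2} \<Longrightarrow> \<bar>P t\<bar> \<le> B"
    using continuous_on_Icc_bound[OF cont_P] by metis
  define E where "E = (\<lambda>t. (u t - x t)\<^sup>2 + (v t - y t)\<^sup>2)"
  have "E t \<le> E T1 * exp ((B + L) * (t - T1))"
  proof (rule gronwall_exceptional[OF finite.emptyI _ _ t])
    show "continuous_on {T1..T2} E"
      unfolding E_def using sol by (intro continuous_intros) (auto simp: phase_solution_def)
    fix s assume s: "s \<in> {T1<..<T2} - {}"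
    let ?x = "u s - x s" and ?y = "v s - y s"
    let ?f = "force M N s (u s) - force M N s (x s)"
    have d: "(u has_real_derivative P s * v s) (at s)"
      "(v has_real_derivative force M N s (u s)) (at s)"
      "(x has_real_derivative P s * y s) (at s)"
      "(y has_real_derivative force M N s (x s)) (at s)"
      using sol s by (auto simp: phase_solution_def)
    have "(E has_real_derivative 2 * ?x * (P s * ?y) + 2 * ?y * ?f) (at s)"
      unfolding E_def by (auto intro!: derivative_eq_intros d simp: algebra_simps)
    moreover have "2 * ?x * (P s * ?y) + 2 * ?y * ?f \<le> (B + L) * E s"
    proof -
      have xy: "2 * \<bar>?x\<bar> * \<bar>?y\<bar> \<le> ?x\<^sup>2 + ?y\<^sup>2"
        using sum_squares_bound[of "\<bar>?x\<bar>" "\<bar>?y\<bar>"] by simp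
      have "2 * ?x * (P s * ?y) \<le> \<bar>P s\<bar> * (2 * \<bar>?x\<bar> * \<bar>?y\<bar>)"
        by (rule order_trans[OF abs_ge_self]) (simp only: abs_mult abs_numeral mult_ac order_refl)
      also have "\<dots> \<le> B * (?x\<^sup>2 + ?y\<^sup>2)" using B s xy by (intro mult_mono) auto
      finally have 1: "2 * ?x * (P s * ?y) \<le> B * (?x\<^sup>2 + ?y\<^sup>2)" .
      have "2 * ?y * ?f \<le> 2 * \<bar>?y\<bar> * \<bar>?f\<bar>"
        by (rule order_trans[OF abs_ge_self]) (simp only: abs_mult abs_numeral mult_ac order_refl)
      also have "\<dots> \<le> 2 * \<bar>?y\<bar> * (L * \<bar>?x\<bar>)" using L(2)[of s] s by (intro mult_left_mono) auto
      also have "\<dots> = L * (2 * \<bar>?x\<bar> * \<bar>?y\<bar>)" by simp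
      also have "\<dots> \<le> L * (?x\<^sup>2 + ?y\<^sup>2)" using L(1) xy by (intro mult_left_mono) auto
      finally show ?thesis using 1 by (simp add: E_def algebra_simps)
    qed
    ultimately show "\<exists>d. (E has_real_derivative d) (at s) \<and> d \<le> (B + L) * E s" by blast
  qed
  then have "E t \<le> 0" by (simp add: E_def init)
  then show ?thesis by (simp add: E_def sum_power2_le_zero_iff)
qed

text \<open>Once the angle is known, the amplitude solves a linear equation
  \<open>R' = R * g\<close>; it is therefore an explicit exponential and never vanishes.\<close>

lemma prufer_amplitude:
  assumes \<theta>: "prufer_angle M N \<theta>"
    and cont: "continuous_on {T1..T2} M" "continuous_on {T1..T2} N" and "c > 0"
  obtains R where "\<And>t. R t > 0" "R T1 = c"
    "\<And>t. t \<in> {T1..T2} \<Longrightarrow>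
      ((\<lambda>t. R t * sin (\<theta> t)) has_real_derivative P t * (R t * cos (\<theta> t))) (at t within {T1..T2})"
    "\<And>t. t \<in> {T1..T2} \<Longrightarrow>
      ((\<lambda>t. R t * cos (\<theta> t)) has_real_derivative force M N t (R t * sin (\<theta> t)))
        (at t within {T1..T2})"
proof -
  \<comment> \<open>Read off from \<open>R R' = u u' + v v'\<close> after division by
    \<open>R^2\<close>.\<close>
  define g where "g = (\<lambda>t. cos (\<theta> t) * (P t * sin (\<theta> t) + force M N t (sin (\<theta> t))))"
  define R where "R = (\<lambda>t. c * exp (integral {T1..t} g))"
  have "continuous_on {T1..T2} \<theta>" by (rule prufer_angle_continuous[OF \<theta>]) auto
  then have "continuous_on {T1..T2} g"
    unfolding g_def force_def by (intro continuous_intros cont_P cont_q cont)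
  then have dI: "((\<lambda>t. integral {T1..t} g) has_real_derivative g t) (at t within {T1..T2})"
    if "t \<in> {T1..T2}" for t using integral_has_real_derivative that by blast
  have dR: "(R has_real_derivative R t * g t) (at t within {T1..T2})" if "t \<in> {T1..T2}" for t
    unfolding R_def by (auto intro!: derivative_eq_intros dI that)
  have d\<theta>: "(\<theta> has_real_derivative speed M N t (\<theta> t)) (at t within {T1..T2})"
    if "t \<in> {T1..T2}" for t using \<theta> that by (auto simp: prufer_angle_def)
  have pos: "R t > 0" for t using \<open>c > 0\<close> by (simp add: R_def)
  show thesis
  proof (rule that[of R])
    fix t assume t: "t \<in> {T1..T2}"
    have "((\<lambda>t. R t * sin (\<theta> t)) has_real_derivative
        R t * g t * sin (\<theta> t) + R t * (cos (\<theta> t) * speed M N t (\<theta> t))) (at t within {T1..T2})"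
      by (auto intro!: derivative_eq_intros dR d\<theta> t)
    also have "R t * g t * sin (\<theta> t) + R t * (cos (\<theta> t) * speed M N t (\<theta> t))
        = P t * (R t * cos (\<theta> t)) * ((sin (\<theta> t))\<^sup>2 + (cos (\<theta> t))\<^sup>2)"
      unfolding g_def speed_def by (simp add: algebra_simps power2_eq_square del: sin_cos_squared_add3)
    finally show "((\<lambda>t. R t * sin (\<theta> t)) has_real_derivative P t * (R t * cos (\<theta> t)))
        (at t within {T1..T2})" by simp
    have "((\<lambda>t. R t * cos (\<theta> t)) has_real_derivative
        R t * g t * cos (\<theta> t) - R t * (sin (\<theta> t) * speed M N t (\<theta> t))) (at t within {T1..T2})"
      by (auto intro!: derivative_eq_intros dR d\<theta> t)
    also have "R t * g t * cos (\<theta> t) - R t * (sin (\<theta> t) * speed M N t (\<theta> t))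
        = R t * force M N t (sin (\<theta> t)) * ((sin (\<theta> t))\<^sup>2 + (cos (\<theta> t))\<^sup>2)"
      unfolding g_def speed_def by (simp add: algebra_simps power2_eq_square del: sin_cos_squared_add3)
    finally show "((\<lambda>t. R t * cos (\<theta> t)) has_real_derivative force M N t (R t * sin (\<theta> t)))
        (at t within {T1..T2})" by (simp add: force_scale pos)
  qed (use pos in \<open>auto simp: R_def\<close>)
qed

text \<open>Uniqueness identifies the given solution with the one built from the angle, so no branch
  of the argument has to be followed along \<open>u\<close> and \<open>v\<close>.\<close>

lemma phase_solution_polar:
  assumes \<theta>: "prufer_angle M N \<theta>"
    and cont: "continuous_on {T1..T2} M" "continuous_on {T1..T2} N"
    and uv: "phase_solution M N u v"
    and init: "u T1 = c * sin (\<theta> T1)" "v T1 = c * cos (\<theta> T1)" "c > 0"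
  obtains R where "\<And>t. R t > 0"
    "\<And>t. t \<in> {T1..T2} \<Longrightarrow> u t = R t * sin (\<theta> t) \<and> v t = R t * cos (\<theta> t)"
proof -
  obtain R where R: "\<And>t. R t > 0" "R T1 = c"
    "\<And>t. t \<in> {T1..T2} \<Longrightarrow>
      ((\<lambda>t. R t * sin (\<theta> t)) has_real_derivative P t * (R t * cos (\<theta> t))) (at t within {T1..T2})"
    "\<And>t. t \<in> {T1..T2} \<Longrightarrow>
      ((\<lambda>t. R t * cos (\<theta> t)) has_real_derivative force M N t (R t * sin (\<theta> t)))
        (at t within {T1..T2})"
    using prufer_amplitude[OF \<theta> cont \<open>c > 0\<close>] by blast
  have "phase_solution M N (\<lambda>t. R t * sin (\<theta> t)) (\<lambda>t. R t * cos (\<theta> t))"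
    unfolding phase_solution_def
  proof (intro conjI ballI)
    show "continuous_on {T1..T2} (\<lambda>t. R t * sin (\<theta> t))"
      "continuous_on {T1..T2} (\<lambda>t. R t * cos (\<theta> t))"
      using R(3,4) DERIV_continuous continuous_on_eq_continuous_within by blast+
    fix t assume t: "t \<in> {T1<..<T2}"
    then have "at t within {T1..T2} = at t" by (simp add: at_within_Icc_at)
    with R(3,4)[of t] t
    show "((\<lambda>t. R t * sin (\<theta> t)) has_real_derivative P t * (R t * cos (\<theta> t))) (at t)"
      "((\<lambda>t. R t * cos (\<theta> t)) has_real_derivative force M N t (R t * sin (\<theta> t))) (at t)"
      by auto
  qed
  from phase_solution_unique[OF cont uv this] show thesis
    by (intro that[of R]) (use R(1,2) init in auto)
qed

text \<open>The value at \<open>T2\<close> serves twice: the cosine vanishes there, which is the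
  Neumann condition, and the index \<open>i + k\<close> fixes the number of zeros.\<close>

definition neumann_angle :: "nat \<Rightarrow> nat \<Rightarrow> (real \<Rightarrow> real) \<Rightarrow> (real \<Rightarrow> real) \<Rightarrow> bool" where
  "neumann_angle i k M N \<longleftrightarrow>
    (\<exists>\<theta>. prufer_angle M N \<theta> \<and> \<theta> T1 = real i * pi + pi / 2 \<and> \<theta> T2 = real (i + k) * pi + pi / 2)"

end

section \<open>Correspondence between Neumann solutions and Pruefer angles\<close>

lemma sin_odd_multiple: "sin (real j * pi + pi / 2) = (- 1) ^ j"
  by (simp add: sin_add cos_npi)

lemma cos_odd_multiple: "cos (real j * pi + pi / 2) = 0"
  by (simp add: cos_add sin_npi)

locale neumann_problem =
  fixes T1 T2 :: real and p q m n :: "real \<Rightarrow> real"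
  assumes less: "T1 < T2"
    and cont: "continuous_on {T1..T2} p" "continuous_on {T1..T2} q"
      "continuous_on {T1..T2} m" "continuous_on {T1..T2} n"
    and p_pos: "t \<in> {T1..T2} \<Longrightarrow> p t > 0" and q_ge_0: "t \<in> {T1..T2} \<Longrightarrow> q t \<ge> 0"
begin

sublocale prufer T1 T2 "\<lambda>t. 1 / p t" q
proof
  show "continuous_on {T1..T2} (\<lambda>t. 1 / p t)"
    using p_pos by (intro continuous_intros cont) force
qed (use less cont p_pos q_ge_0 in auto)

abbreviation wm :: "real \<Rightarrow> real \<Rightarrow> real" where "wm a \<equiv> \<lambda>t. a * m t"
abbreviation wn :: "real \<Rightarrow> real \<Rightarrow> real" where "wn b \<equiv> \<lambda>t. b * n t"

lemma cont_weights: "continuous_on {T1..T2} (wm a)" "continuous_on {T1..T2} (wn b)"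
  by (intro continuous_intros cont)+

lemma neumann_solution_phase:
  assumes "neumann_solution T1 T2 p q m n a b u"
  obtains v where "phase_solution (wm a) (wn b) u v" "v T1 = 0" "v T2 = 0"
proof -
  obtain u' w where u:
    "\<And>t. t \<in> {T1..T2} \<Longrightarrow> (u has_real_derivative u' t) (at t within {T1..T2})"
    "continuous_on {T1..T2} u'"
    "\<And>t. t \<in> {T1<..<T2} \<Longrightarrow> ((\<lambda>s. p s * u' s) has_real_derivative w t) (at t)"
    "\<And>t. t \<in> {T1<..<T2} \<Longrightarrow> - w t + q t * u t = a * m t * max (u t) 0 - b * n t * max (- u t) 0"
    "u' T1 = 0" "u' T2 = 0"
    using assms unfolding neumann_solution_def by blast
  have "phase_solution (wm a) (wn b) u (\<lambda>s. p s * u' s)"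
    unfolding phase_solution_def
  proof (intro conjI ballI)
    show "continuous_on {T1..T2} u"
      using u(1) DERIV_continuous continuous_on_eq_continuous_within by blast
    show "continuous_on {T1..T2} (\<lambda>s. p s * u' s)" by (intro continuous_intros cont u)
    fix t assume t: "t \<in> {T1<..<T2}"
    then have "at t within {T1..T2} = at t" by (simp add: at_within_Icc_at)
    with u(1)[of t] t p_pos[of t] show "(u has_real_derivative 1 / p t * (p t * u' t)) (at t)"
      by auto
    have "w t = force (wm a) (wn b) t (u t)" using u(4)[OF t] by (simp add: force_def)
    with u(3)[OF t]
    show "((\<lambda>s. p s * u' s) has_real_derivative force (wm a) (wn b) t (u t)) (at t)" by simp
  qed
  then show thesis using u by (intro that[of "\<lambda>s. p s * u' s"]) auto
qed

lemma neumann_angle_of_solution: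
  assumes "nontrivial_solution_zeros T1 T2 p q m n k a b u"
  obtains i where "i \<in> {0, 1}" "neumann_angle i k (wm a) (wn b)" "u T2 > 0 \<longleftrightarrow> even (i + k)"
proof -
  have sol: "neumann_solution T1 T2 p q m n a b u" and nz: "\<exists>t\<in>{T1..T2}. u t \<noteq> 0"
    and card: "card {t \<in> {T1<..<T2}. u t = 0} = k"
    using assms by (auto simp: nontrivial_solution_zeros_def)
  obtain v where v: "phase_solution (wm a) (wn b) u v" "v T1 = 0" "v T2 = 0"
    using neumann_solution_phase[OF sol] by blast
  \<comment> \<open>As \<open>v T1 = 0\<close>, a zero of \<open>u\<close> at \<open>T1\<close>
    would make the solution trivial by uniqueness.\<close>
  have "u T1 \<noteq> 0"
  proof
    assume "u T1 = 0"
    have "phase_solution (wm a) (wn b) (\<lambda>_. 0) (\<lambda>_. 0)"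
      by (auto simp: phase_solution_def force_def)
    from phase_solution_unique[OF cont_weights v(1) this] nz \<open>u T1 = 0\<close> v(2)
    show False by auto
  qed
  \<comment> \<open>Chosen so that \<open>(- 1) ^ i\<close> is the sign of
    \<open>u T1\<close>.\<close>
  define i where "i = (if u T1 > 0 then 0 else 1 :: nat)"
  have sgn: "u T1 = \<bar>u T1\<bar> * sin (real i * pi + pi / 2)"
    by (simp add: sin_odd_multiple) (auto simp: i_def)
  obtain \<theta> where \<theta>: "prufer_angle (wm a) (wn b) \<theta>" "\<theta> T1 = real i * pi + pi / 2"
    using prufer_angle_exists[OF cont_weights] by blast
  obtain R where R: "\<And>t. R t > 0"
    "\<And>t. t \<in> {T1..T2} \<Longrightarrow> u t = R t * sin (\<theta> t) \<and> v t = R t * cos (\<theta> t)"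
    by (rule phase_solution_polar[OF \<theta>(1) cont_weights v(1), of "\<bar>u T1\<bar>"])
      (use \<open>u T1 \<noteq> 0\<close> sgn v(2) \<theta>(2) in \<open>auto simp: cos_odd_multiple\<close>)
  have T: "T1 \<in> {T1..T2}" "T2 \<in> {T1..T2}" using less by auto
  have "cos (\<theta> T2) = 0" using R(1)[of T2] R(2)[OF T(2)] v(3) by auto
  then obtain j :: int where j: "\<theta> T2 = of_int j * pi + pi / 2" by (auto simp: cos_zero_iff_int2)
  \<comment> \<open>The angle stays above \<open>i * pi\<close>, so the integer \<open>j\<close> is
    at least \<open>i\<close> and their difference is a natural number, the zero count.\<close>
  have "real i * pi < \<theta> T2"
    using less \<theta> by (intro prufer_angle_above_strict[OF \<theta>(1) cont_weights, of T1])
      (auto simp: sin_nat_pi)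
  then have "real_of_int (int i) * pi < (real_of_int j + 1) * pi"
    using pi_gt_zero unfolding j distrib_right by (simp, linarith)
  then have "real_of_int (int i) < real_of_int (j + 1)" by (simp add: mult_less_cancel_right_pos)
  then have "int i \<le> j" by linarith
  then obtain l where l: "j = int (i + l)" by (metis zle_iff_zadd of_nat_add)
  then have end2: "\<theta> T2 = real (i + l) * pi + pi / 2" using j by simp
  have "{t \<in> {T1<..<T2}. u t = 0} = {t \<in> {T1<..<T2}. sin (\<theta> t) = 0}"
  proof -
    have "u t = 0 \<longleftrightarrow> sin (\<theta> t) = 0" if "t \<in> {T1<..<T2}" for t
      using R(1)[of t] R(2)[of t] that by simp
    then show ?thesis by blast
  qed
  then have "l = k" using card prufer_angle_zeros(2)[OF \<theta>(1) cont_weights \<theta>(2) end2] by simp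
  with \<theta> end2 have na: "neumann_angle i k (wm a) (wn b)" by (auto simp: neumann_angle_def)
  have "u T2 = R T2 * (- 1) ^ (i + k)"
    using R(2)[OF T(2)] end2 \<open>l = k\<close> by (simp only: sin_odd_multiple)
  then have "u T2 > 0 \<longleftrightarrow> even (i + k)"
    using R(1)[of T2] by (cases "even (i + k)") (auto simp: uminus_power_if)
  then show thesis by (intro that[OF _ na]) (auto simp: i_def)
qed

lemma solution_of_neumann_angle:
  assumes "neumann_angle i k (wm a) (wn b)"
  obtains u where "nontrivial_solution_zeros T1 T2 p q m n k a b u"
    "u T2 \<noteq> 0" "u T2 > 0 \<longleftrightarrow> even (i + k)"
proof -
  obtain \<theta> where \<theta>: "prufer_angle (wm a) (wn b) \<theta>" "\<theta> T1 = real i * pi + pi / 2"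
      "\<theta> T2 = real (i + k) * pi + pi / 2"
    using assms by (auto simp: neumann_angle_def)
  obtain R where R: "\<And>t. R t > 0"
    "\<And>t. t \<in> {T1..T2} \<Longrightarrow> ((\<lambda>t. R t * sin (\<theta> t)) has_real_derivative
        1 / p t * (R t * cos (\<theta> t))) (at t within {T1..T2})"
    "\<And>t. t \<in> {T1..T2} \<Longrightarrow> ((\<lambda>t. R t * cos (\<theta> t)) has_real_derivative
        force (wm a) (wn b) t (R t * sin (\<theta> t))) (at t within {T1..T2})"
    by (rule prufer_amplitude[OF \<theta>(1) cont_weights zero_less_one], rule that)
  let ?u = "\<lambda>t. R t * sin (\<theta> t)" and ?u' = "\<lambda>t. 1 / p t * (R t * cos (\<theta> t))"
  have T: "T1 \<in> {T1..T2}" "T2 \<in> {T1..T2}" using less by auto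
  have "neumann_solution T1 T2 p q m n a b ?u"
    unfolding neumann_solution_def
  proof (rule exI[of _ ?u'], rule exI[of _ "\<lambda>t. force (wm a) (wn b) t (?u t)"], intro conjI ballI)
    fix t assume "t \<in> {T1..T2}"
    then show "(?u has_real_derivative ?u' t) (at t within {T1..T2})" by (rule R(2))
  next
    have "continuous_on {T1..T2} (\<lambda>t. R t * cos (\<theta> t))"
      using R(3) DERIV_continuous continuous_on_eq_continuous_within by blast
    then show "continuous_on {T1..T2} ?u'" by (rule continuous_on_mult[OF cont_P])
  next
    fix t assume t: "t \<in> {T1<..<T2}"
    then have "at t within {T1..T2} = at t" by (simp add: at_within_Icc_at)
    with R(3)[of t] t have d: "((\<lambda>t. R t * cos (\<theta> t)) has_real_derivative
        force (wm a) (wn b) t (?u t)) (at t)" by (simp only: greaterThanLessThan_iff atLeastAtMost_iff less_imp_le)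
    \<comment> \<open>Cancelling \<open>p\<close> requires \<open>p s \<noteq> 0\<close>, known on
      the interval only; the derivative is therefore transferred through a neighbourhood of
      \<open>t\<close>.\<close>
    have ev: "\<forall>\<^sub>F s in nhds t. p s * ?u' s = R s * cos (\<theta> s)"
      using eventually_nhds_in_open[OF open_greaterThanLessThan t]
      by eventually_elim (use p_pos in \<open>simp add: less_imp_neq[symmetric]\<close>)
    show "((\<lambda>s. p s * ?u' s) has_real_derivative force (wm a) (wn b) t (?u t)) (at t)"
      using DERIV_cong_ev[OF refl ev refl] d by simp
    show "- force (wm a) (wn b) t (?u t) + q t * ?u t
        = a * m t * max (?u t) 0 - b * n t * max (- ?u t) 0"
      by (simp add: force_def)
  qed (simp_all add: \<theta>(2,3) cos_odd_multiple del: of_nat_add)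
  moreover have Z: "{t \<in> {T1<..<T2}. ?u t = 0} = {t \<in> {T1<..<T2}. sin (\<theta> t) = 0}"
    using R(1) by (simp add: less_imp_neq[OF R(1), symmetric])
  moreover have uT2: "?u T2 = R T2 * (- 1) ^ (i + k)" by (simp only: \<theta>(3) sin_odd_multiple)
  moreover have "?u T2 \<noteq> 0" using R(1)[of T2] unfolding uT2 by simp
  moreover have "?u T2 > 0 \<longleftrightarrow> even (i + k)"
    unfolding uT2 using R(1)[of T2] by (cases "even (i + k)") (auto simp: uminus_power_if)
  ultimately show thesis
    using T prufer_angle_zeros[OF \<theta>(1) cont_weights \<theta>(2,3)]
    by (intro that[of ?u]) (unfold nontrivial_solution_zeros_def Z, blast+)
qed

text \<open>The sine at the final angle is \<open>(- 1) ^ (i + k)\<close>, so the parity of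
  \<open>i + k\<close> decides the sign of \<open>u\<close> at \<open>T2\<close>.\<close>

lemma mem_C_gt_iff:
  "(a, b) \<in> C_gt T1 T2 p q m n k \<longleftrightarrow>
    (\<exists>i\<in>{0, 1}. even (i + k) \<and> neumann_angle i k (wm a) (wn b))"
  unfolding C_gt_def
  unfolding mem_Collect_eq case_prod_conv
  by (metis neumann_angle_of_solution solution_of_neumann_angle)

lemma mem_C_lt_iff:
  "(a, b) \<in> C_lt T1 T2 p q m n k \<longleftrightarrow>
    (\<exists>i\<in>{0, 1}. odd (i + k) \<and> neumann_angle i k (wm a) (wn b))"
  unfolding C_lt_def
  unfolding mem_Collect_eq case_prod_conv
  by (metis neumann_angle_of_solution solution_of_neumann_angle less_asym linorder_neqE_linordered_idom)

end

section \<open>Rescaling the angle\<close>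

text \<open>The branch of \<open>arccot (c cot x)\<close> that fixes the multiples of \<open>pi / 2\<close>.\<close>

definition squeeze :: "real \<Rightarrow> real \<Rightarrow> real" where
  "squeeze c x = x - arctan ((c - 1) * sin x * cos x / (c * (cos x)\<^sup>2 + (sin x)\<^sup>2))"

lemma squeeze_fixed: "sin x = 0 \<or> cos x = 0 \<Longrightarrow> squeeze c x = x"
  by (auto simp: squeeze_def)

context
  fixes c :: real
  assumes c: "c > 0"
begin

lemma squeeze_denominators:
  "c * (cos x)\<^sup>2 + (sin x)\<^sup>2 > 0" "(sin x)\<^sup>2 + c\<^sup>2 * (cos x)\<^sup>2 > 0"
proof -
  have "r * (cos x)\<^sup>2 + (sin x)\<^sup>2 > 0" if "r > 0" for r
  proof (cases "sin x = 0")
    case True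
    then show ?thesis using that by (simp add: cos_squared_eq)
  next
    case False
    then show ?thesis using that by (intro add_nonneg_pos) auto
  qed
  from this[of c] this[of "c\<^sup>2"] c show "c * (cos x)\<^sup>2 + (sin x)\<^sup>2 > 0"
    "(sin x)\<^sup>2 + c\<^sup>2 * (cos x)\<^sup>2 > 0" by (auto simp: add.commute)
qed

lemma squeeze_identity:
  "(c * (cos x)\<^sup>2 + (sin x)\<^sup>2)\<^sup>2 + ((c - 1) * sin x * cos x)\<^sup>2 = (sin x)\<^sup>2 + c\<^sup>2 * (cos x)\<^sup>2"
proof -
  \<comment> \<open>An extra factor \<open>sin^2 + cos^2\<close> makes both sides homogeneous of
    degree four, hence equal as polynomials in sine and cosine.\<close>
  have "(c * (cos x)\<^sup>2 + (sin x)\<^sup>2)\<^sup>2 + ((c - 1) * sin x * cos x)\<^sup>2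
      = ((sin x)\<^sup>2 + c\<^sup>2 * (cos x)\<^sup>2) * ((sin x)\<^sup>2 + (cos x)\<^sup>2)"
    by algebra
  then show ?thesis by simp
qed

text \<open>The arctangent in \<open>squeeze\<close> is the angle between the vectors
  \<open>(cos x, sin x)\<close> and \<open>(c * cos x, sin x)\<close>: its argument is their cross
  product over their inner product. Subtracting it leaves the direction of the second
  vector.\<close>

lemma sin_cos_squeeze:
  "sin (squeeze c x) = sin x / sqrt ((sin x)\<^sup>2 + c\<^sup>2 * (cos x)\<^sup>2)"
  "cos (squeeze c x) = c * cos x / sqrt ((sin x)\<^sup>2 + c\<^sup>2 * (cos x)\<^sup>2)"
proof -
  define D where "D = c * (cos x)\<^sup>2 + (sin x)\<^sup>2"
  define N where "N = (c - 1) * sin x * cos x"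
  define w where "w = (sin x)\<^sup>2 + c\<^sup>2 * (cos x)\<^sup>2"
  have D: "D > 0" and w: "w > 0" using squeeze_denominators by (auto simp: D_def w_def)
  have "D\<^sup>2 + N\<^sup>2 = w" unfolding D_def N_def w_def by (rule squeeze_identity)
  then have "1 + (N / D)\<^sup>2 = w / D\<^sup>2" using D by (simp add: power_divide field_simps)
  then have sq: "sqrt (1 + (N / D)\<^sup>2) = sqrt w / D" using D by (simp add: real_sqrt_divide)
  have "sin x * D - cos x * N = sin x * ((sin x)\<^sup>2 + (cos x)\<^sup>2)"
    unfolding D_def N_def by algebra
  then have s: "sin x * D - cos x * N = sin x" by simp
  have "cos x * D + sin x * N = c * cos x * ((sin x)\<^sup>2 + (cos x)\<^sup>2)"
    unfolding D_def N_def by algebra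
  then have c': "cos x * D + sin x * N = c * cos x" by simp
  have "sin (squeeze c x) = (sin x * D - cos x * N) / sqrt w"
    unfolding squeeze_def D_def[symmetric] N_def[symmetric] sin_diff sin_arctan cos_arctan sq
    using D w by (simp add: field_simps)
  then show "sin (squeeze c x) = sin x / sqrt ((sin x)\<^sup>2 + c\<^sup>2 * (cos x)\<^sup>2)"
    by (simp add: s w_def)
  have "cos (squeeze c x) = (cos x * D + sin x * N) / sqrt w"
    unfolding squeeze_def D_def[symmetric] N_def[symmetric] cos_diff sin_arctan cos_arctan sq
    using D w by (simp add: field_simps)
  then show "cos (squeeze c x) = c * cos x / sqrt ((sin x)\<^sup>2 + c\<^sup>2 * (cos x)\<^sup>2)"
    by (simp add: c' w_def)
qed

lemma DERIV_squeeze: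
  "(squeeze c has_real_derivative c / ((sin x)\<^sup>2 + c\<^sup>2 * (cos x)\<^sup>2)) (at x)"
proof -
  define D where "D = c * (cos x)\<^sup>2 + (sin x)\<^sup>2"
  define N where "N = (c - 1) * sin x * cos x"
  define N' where "N' = (c - 1) * ((cos x)\<^sup>2 - (sin x)\<^sup>2)"
  define D' where "D' = - 2 * (c - 1) * sin x * cos x"
  define w where "w = (sin x)\<^sup>2 + c\<^sup>2 * (cos x)\<^sup>2"
  have D: "D > 0" and w: "w > 0" using squeeze_denominators by (auto simp: D_def w_def)
  have dN: "((\<lambda>x. (c - 1) * sin x * cos x) has_real_derivative N') (at x)"
    unfolding N'_def by (auto intro!: derivative_eq_intros simp: algebra_simps power2_eq_square)
  have dD: "((\<lambda>x. c * (cos x)\<^sup>2 + (sin x)\<^sup>2) has_real_derivative D') (at x)"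
    unfolding D'_def by (auto intro!: derivative_eq_intros simp: algebra_simps)
  have "(squeeze c has_real_derivative
      1 - inverse (1 + (N / D)\<^sup>2) * ((N' * D - N * D') / (D * D))) (at x)"
    unfolding squeeze_def[abs_def] D_def N_def
    by (rule DERIV_diff[OF DERIV_ident DERIV_chain2[OF DERIV_arctan DERIV_divide[OF dN dD]]])
      (use squeeze_denominators(1)[of x] in simp)
  also have "inverse (1 + (N / D)\<^sup>2) * ((N' * D - N * D') / (D * D)) = (N' * D - N * D') / w"
  proof -
    have "D\<^sup>2 + N\<^sup>2 = w" unfolding D_def N_def w_def by (rule squeeze_identity)
    then have "1 + (N / D)\<^sup>2 = w / D\<^sup>2" using D by (simp add: power_divide field_simps)
    then show ?thesis using D w by (simp add: field_simps power2_eq_square)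
  qed
  also have "1 - (N' * D - N * D') / w = (w - (N' * D - N * D')) / w"
    using w by (simp add: field_simps)
  also have "w - (N' * D - N * D') = c"
  proof -
    have "w * ((sin x)\<^sup>2 + (cos x)\<^sup>2) - (N' * D - N * D') = c * ((sin x)\<^sup>2 + (cos x)\<^sup>2)\<^sup>2"
      unfolding w_def N'_def D_def N_def D'_def by algebra
    then show ?thesis by simp
  qed
  finally show ?thesis by (simp add: w_def)
qed

lemma squeeze_strict_mono: "x < y \<Longrightarrow> squeeze c x < squeeze c y"
  using DERIV_squeeze squeeze_denominators(2) c
  by (intro DERIV_pos_imp_increasing[of x y "squeeze c"]) (auto intro!: exI divide_pos_pos)

lemma squeeze_mono: "x \<le> y \<Longrightarrow> squeeze c x \<le> squeeze c y"
  using squeeze_strict_mono by (auto simp: order_le_less)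

lemma continuous_on_squeeze: "continuous_on A (squeeze c)"
  using DERIV_squeeze DERIV_isCont by (blast intro: continuous_at_imp_continuous_on)

end

section \<open>Monotonicity in the weight of the negative part\<close>

context prufer
begin

text \<open>On the half-turns where \<open>u < 0\<close>, the quotient \<open>p u' / (c u)\<close> for the weight \<open>c N\<close> and
  \<open>p u' / u\<close> for the weight \<open>N\<close> satisfy Riccati equations that can be compared because
  \<open>q \<ge> 0\<close>, whatever the sign of \<open>N\<close>. Squeezing the angle there, and only there, gives a subsolution.\<close>

lemma prufer_angle_weight_mono:
  assumes \<theta>: "prufer_angle M N \<theta>" and \<phi>: "prufer_angle M (\<lambda>t. c * N t) \<phi>" and "c \<ge> 1"
    and cont: "continuous_on {T1..T2} M" "continuous_on {T1..T2} N"
    and "\<theta> T1 = \<phi> T1" "cos (\<theta> T1) = 0" "cos (\<theta> T2) = 0"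
    and fin: "finite {t \<in> {T1<..<T2}. sin (\<theta> t) = 0}"
  shows "\<theta> T2 \<le> \<phi> T2"
proof -
  have c: "c > 0" using \<open>c \<ge> 1\<close> by simp
  \<comment> \<open>Both branches agree where the sine vanishes, so \<open>g\<close> is continuous;
    a derivative is needed only away from those zeros.\<close>
  define g where "g = (\<lambda>x. if sin x \<le> 0 then squeeze c x else x)"
  have "continuous_on UNIV g"
    unfolding g_def
    by (rule continuous_on_cases_le)
      (auto intro!: continuous_on_squeeze continuous_intros c simp: squeeze_fixed)
  then have cg: "continuous_on {T1..T2} (\<lambda>t. g (\<theta> t))"
    by (rule continuous_on_compose2) (auto intro: prufer_angle_continuous[OF \<theta>])
  have g_fixed: "g x = x" if "cos x = 0" for x using that by (simp add: g_def squeeze_fixed)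
  have "g (\<theta> T2) \<le> \<phi> T2"
  proof (rule prufer_angle_super[OF \<phi> _ _ _ _ cg fin])
    show "continuous_on {T1..T2} (\<lambda>t. c * N t)" by (intro continuous_intros cont)
    fix t assume t: "t \<in> {T1<..<T2} - {t \<in> {T1<..<T2}. sin (\<theta> t) = 0}"
    have c\<theta>: "continuous_on {T1<..<T2} (\<lambda>t. sin (\<theta> t))"
      by (intro continuous_intros continuous_on_subset[OF prufer_angle_continuous[OF \<theta> order_refl order_refl]])
        auto
    have d\<theta>: "(\<theta> has_real_derivative speed M N t (\<theta> t)) (at t)"
      using prufer_angle_deriv[OF \<theta>] t by auto
    consider "sin (\<theta> t) > 0" | "sin (\<theta> t) < 0" using t by (auto simp: neq_iff)
    then show "\<exists>d. ((\<lambda>t. g (\<theta> t)) has_real_derivative d) (at t)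
        \<and> d \<le> speed M (\<lambda>t. c * N t) t (g (\<theta> t))"
    proof cases
      case 1
      have "open ({T1<..<T2} \<inter> (\<lambda>t. sin (\<theta> t)) -` {0<..})"
        by (intro continuous_open_preimage c\<theta>) auto
      with d\<theta> have "((\<lambda>t. g (\<theta> t)) has_real_derivative speed M N t (\<theta> t)) (at t)"
        by (rule has_field_derivative_transform_within_open) (use 1 t in \<open>auto simp: g_def\<close>)
      moreover have "speed M N t (\<theta> t) = speed M (\<lambda>t. c * N t) t (g (\<theta> t))"
        using 1 by (simp add: g_def speed_alt max_def)
      ultimately show ?thesis by (intro exI[of _ "speed M N t (\<theta> t)"]) simp
    next
      case 2
      define s k w where "s = sin (\<theta> t)" and "k = cos (\<theta> t)" and "w = s\<^sup>2 + c\<^sup>2 * k\<^sup>2"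
      have w: "w > 0" unfolding w_def s_def k_def by (rule squeeze_denominators[OF c])
      have "((\<lambda>t. squeeze c (\<theta> t)) has_real_derivative c / w * speed M N t (\<theta> t)) (at t)"
        unfolding w_def s_def k_def by (rule DERIV_chain2[OF DERIV_squeeze[OF c] d\<theta>])
      moreover have "open ({T1<..<T2} \<inter> (\<lambda>t. sin (\<theta> t)) -` {..<0})"
        by (intro continuous_open_preimage c\<theta>) auto
      ultimately have
        "((\<lambda>t. g (\<theta> t)) has_real_derivative c / w * speed M N t (\<theta> t)) (at t)"
        by (rule has_field_derivative_transform_within_open) (use 2 t in \<open>auto simp: g_def\<close>)
      moreover have "c / w * speed M N t (\<theta> t) \<le> speed M (\<lambda>t. c * N t) t (g (\<theta> t))"
      proof -
        have gs: "g (\<theta> t) = squeeze c (\<theta> t)" using 2 by (simp add: g_def)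
        have sc: "sin (g (\<theta> t)) = s / sqrt w" "cos (g (\<theta> t)) = c * k / sqrt w"
          unfolding gs w_def s_def k_def by (rule sin_cos_squeeze[OF c])+
        have "s < 0" using 2 by (simp add: s_def)
        then have "s / sqrt w < 0" using w by (simp add: divide_less_0_iff)
        \<comment> \<open>The squeezed angle keeps a negative sine, so the weight of the negative
          part is still the one that acts.\<close>
        then have 1: "speed M (\<lambda>t. c * N t) t (g (\<theta> t))
            = (P t * (c\<^sup>2 * k\<^sup>2) - q t * s\<^sup>2 + c * N t * s\<^sup>2) / w"
          unfolding speed_alt sc using w
          by (simp add: max_def power_divide power_mult_distrib add_divide_distrib diff_divide_distrib)
        have 2: "c / w * speed M N t (\<theta> t) = (P t * (c * k\<^sup>2) - c * q t * s\<^sup>2 + c * N t * s\<^sup>2) / w"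
          unfolding speed_alt s_def[symmetric] k_def[symmetric] using \<open>s < 0\<close>
          by (simp add: max_def algebra_simps add_divide_distrib diff_divide_distrib)
        have Pq: "P t > 0" "q t \<ge> 0" using t P_pos q_nonneg by auto
        \<comment> \<open>The terms with \<open>N\<close> coincide. The terms with \<open>P\<close>
          and with \<open>q\<close> are ordered by \<open>c \<ge> 1\<close>, the latter because
          \<open>q t \<ge> 0\<close>.\<close>
        have "P t * (c * k\<^sup>2) \<le> P t * (c\<^sup>2 * k\<^sup>2)"
          using Pq \<open>c \<ge> 1\<close> by (intro mult_left_mono mult_right_mono) (auto simp: power2_eq_square)
        moreover have "q t * s\<^sup>2 \<le> c * q t * s\<^sup>2"
          using Pq \<open>c \<ge> 1\<close> mult_right_mono[of 1 c "q t"] by (intro mult_right_mono) auto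
        ultimately show ?thesis
          unfolding 1 2 using w by (intro divide_right_mono) linarith+
      qed
      ultimately show ?thesis by blast
    qed
  qed (use T1_less_T2 assms g_fixed in auto)
  then show ?thesis using assms g_fixed by simp
qed

section \<open>Alternating positivity of the weights\<close>

text \<open>The weight that acts while the angle is between \<open>j * pi\<close> and
  \<open>Suc j * pi\<close>; there the sine is positive for even \<open>j\<close> and negative for
  odd \<open>j\<close>.\<close>

definition active :: "(real \<Rightarrow> real) \<Rightarrow> (real \<Rightarrow> real) \<Rightarrow> nat \<Rightarrow> real \<Rightarrow> real" where
  "active M N j = (if even j then M else N)"

lemma sin_band:
  assumes "real j * pi < x" "x < real (Suc j) * pi"
  shows "if even j then sin x > 0 else sin x < 0"
proof -
  have "sin (x - real j * pi) > 0"
    using assms by (intro sin_gt_zero) (auto simp: algebra_simps)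
  moreover have "sin (x - real j * pi) = (- 1) ^ j * sin x"
    by (simp add: sin_diff sin_npi cos_npi)
  ultimately show ?thesis by (auto simp: uminus_power_if split: if_splits)
qed

lemma speed_band:
  assumes "real j * pi < x" "x < real (Suc j) * pi"
  shows "speed M N t x = P t * (cos x)\<^sup>2 + (active M N j t - q t) * (sin x)\<^sup>2"
  using sin_band[OF assms] by (auto simp: speed_alt active_def max_def algebra_simps split: if_splits)

text \<open>Were the active weight nonpositive, the angle would be a subsolution for zero weights.
  The midpoint of the band is a constant supersolution for these, as \<open>q \<ge> 0\<close>, so
  the angle could neither reach it from below nor rise above it.\<close>

lemma active_pos_between:
  assumes \<theta>: "prufer_angle M N \<theta>" and ab: "T1 \<le> a" "a \<le> b" "b \<le> T2"
    and band: "\<And>t. t \<in> {a<..<b} \<Longrightarrow> real j * pi < \<theta> t \<and> \<theta> t < real (Suc j) * pi"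
    and ends: "\<theta> a \<le> real j * pi + pi / 2" "real j * pi + pi / 2 \<le> \<theta> b" "\<theta> a \<noteq> \<theta> b"
  shows "\<exists>t\<in>{a<..<b}. active M N j t > 0"
proof (rule ccontr)
  assume "\<not> ?thesis"
  then have neg: "active M N j t \<le> 0" if "t \<in> {a<..<b}" for t using that by force
  let ?c = "real j * pi + pi / 2" and ?F = "speed (\<lambda>_. 0) (\<lambda>_. 0)"
  obtain L where L: "\<And>t x y. t \<in> {T1..T2} \<Longrightarrow> \<bar>?F t x - ?F t y\<bar> \<le> L * \<bar>x - y\<bar>"
    using speed_lipschitz[OF continuous_on_const continuous_on_const] by metis
  have sub: "\<exists>d. (\<theta> has_real_derivative d) (at t) \<and> d \<le> ?F t (\<theta> t)" if "t \<in> {a<..<b}" for t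
  proof -
    have "(active M N j t - q t) * (sin (\<theta> t))\<^sup>2
        \<le> (active (\<lambda>_. 0) (\<lambda>_. 0) j t - q t) * (sin (\<theta> t))\<^sup>2"
      using neg[OF that] by (intro mult_right_mono) (auto simp: active_def)
    then have "speed M N t (\<theta> t) \<le> ?F t (\<theta> t)"
      using band[OF that] by (simp only: speed_band[of j] add_left_mono)
    moreover have "(\<theta> has_real_derivative speed M N t (\<theta> t)) (at t)"
      using that ab by (intro prufer_angle_deriv[OF \<theta>]) auto
    ultimately show ?thesis by blast
  qed
  have super: "\<exists>d. ((\<lambda>_. ?c) has_real_derivative d) (at t) \<and> ?F t ?c \<le> d"
    if "t \<in> {a<..<b}" for t
    using that ab q_nonneg[of t]
    by (intro exI[of _ 0]) (simp add: speed_alt cos_odd_multiple sin_odd_multiple)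
  have cont: "continuous_on {a..b} \<theta>" "continuous_on {a..b} (\<lambda>_. ?c)"
    using prufer_angle_continuous[OF \<theta>] ab by auto
  have L': "\<bar>?F t x - ?F t y\<bar> \<le> L * \<bar>x - y\<bar>" if "t \<in> {a<..<b}" for t x y
    using L[of t] that ab by auto
  show False
  proof (cases "\<theta> a < ?c")
    case True
    from comparison_strict[OF cont L' sub super True, of b] ab ends show False by auto
  next
    case False
    then have "\<theta> a \<le> ?c" using ends by simp
    have "\<theta> b \<le> ?c"
      by (rule comparison_weak[OF finite.emptyI cont L' _ _ \<open>\<theta> a \<le> ?c\<close>]) (use sub super ab in auto)
    with False ends show False by auto
  qed
qed

lemma active_pos_in_band:
  assumes \<theta>: "prufer_angle M N \<theta>"
    and cont: "continuous_on {T1..T2} M" "continuous_on {T1..T2} N"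
    and ends: "\<theta> T1 \<le> real j * pi + pi / 2" "real j * pi + pi / 2 \<le> \<theta> T2" "\<theta> T1 < \<theta> T2"
  shows "\<exists>t\<in>{T1<..<T2}. real j * pi < \<theta> t \<and> \<theta> t < real (Suc j) * pi \<and> active M N j t > 0"
proof -
  let ?c = "real j * pi + pi / 2"
  have top: "real (Suc j) * pi = ?c + pi / 2" by (simp add: algebra_simps)
  \<comment> \<open>A piece of the path inside the open band that either climbs to the midpoint or,
    when the path starts there, leaves it upwards. The offset \<open>pi / 4\<close> keeps the
    auxiliary level away from the borders.\<close>
  obtain a b where ab: "T1 \<le> a" "a \<le> b" "b \<le> T2" "real j * pi < \<theta> a" "\<theta> a \<le> ?c" "?c \<le> \<theta> b"
    "\<theta> b < real (Suc j) * pi" "\<theta> a \<noteq> \<theta> b"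
  proof (cases "\<theta> T1 < ?c")
    case True
    let ?y = "max (\<theta> T1) (real j * pi + pi / 4)"
    have y: "real j * pi < ?y" "?y < ?c" "\<theta> T1 \<le> ?y"
      using True pi_gt_zero by (auto simp: less_max_iff_disj)
    obtain a where a: "T1 \<le> a" "a \<le> T2" "\<theta> a = ?y"
      using prufer_angle_IVT[OF \<theta>, of T1 T2 ?y] T1_less_T2 y ends by auto
    obtain b where "a \<le> b" "b \<le> T2" "\<theta> b = ?c"
      using prufer_angle_IVT[OF \<theta>, of a T2 ?c] a y ends by auto
    with a y top show thesis by (intro that[of a b]) auto
  next
    case False
    let ?y = "min (\<theta> T2) (?c + pi / 4)"
    have y: "?c < ?y" "?y < ?c + pi / 2" "?y \<le> \<theta> T2"
      using False ends pi_gt_zero by (auto simp: min_less_iff_disj)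
    obtain b where "T1 \<le> b" "b \<le> T2" "\<theta> b = ?y"
      using prufer_angle_IVT[OF \<theta>, of T1 T2 ?y] T1_less_T2 y ends by auto
    with y top False ends show thesis by (intro that[of T1 b]) auto
  qed
  have band: "real j * pi < \<theta> t \<and> \<theta> t < real (Suc j) * pi" if "t \<in> {a<..<b}" for t
  proof
    show "real j * pi < \<theta> t"
      using that ab by (intro prufer_angle_above_strict[OF \<theta> cont, of a]) (auto simp: sin_nat_pi)
    show "\<theta> t < real (Suc j) * pi"
    proof (rule ccontr)
      assume "\<not> \<theta> t < real (Suc j) * pi"
      then have "real (Suc j) * pi \<le> \<theta> b"
        using that ab sin_nat_pi[of "Suc j"]
        by (intro prufer_angle_above[OF \<theta> cont, of t b "real (Suc j) * pi"]) (auto simp del: of_nat_Suc)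
      with ab show False by simp
    qed
  qed
  from active_pos_between[OF \<theta> ab(1,2,3) band ab(5,6,8)]
  obtain t where "t \<in> {a<..<b}" "active M N j t > 0" by blast
  with band[of t] ab show ?thesis by (intro bexI[of _ t]) auto
qed

primrec alternating :: "(real \<Rightarrow> real) \<Rightarrow> (real \<Rightarrow> real) \<Rightarrow> nat \<Rightarrow> nat \<Rightarrow> real \<Rightarrow> bool" where
  "alternating M N 0 j a \<longleftrightarrow> True"
| "alternating M N (Suc l) j a \<longleftrightarrow>
    (\<exists>t. a < t \<and> t < T2 \<and> active M N j t > 0 \<and> alternating M N l (Suc j) t)"

lemma alternating_mono:
  assumes "\<And>j t. active M N j t > 0 \<Longrightarrow> active M' N' j t > 0"
  shows "alternating M N l j a \<Longrightarrow> alternating M' N' l j a"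
proof (induction l arbitrary: j a)
  case (Suc l)
  then show ?case using assms by (simp, blast)
qed simp

lemma active_parity: "active M N (Suc (Suc j)) = active M N j"
  by (simp add: active_def)

lemma alternating_parity: "alternating M N l (Suc (Suc j)) a = alternating M N l j a"
  by (induction l arbitrary: j a) (simp_all add: active_parity)

text \<open>Of the first points of the two chains, the earlier one can be put in front of the other
  chain. If they coincide, \<open>N\<close> is positive there and, by continuity, also slightly to
  the left, so a point with \<open>N > 0\<close> can precede the chain starting with
  \<open>M\<close>.\<close>

lemma alternating_prepend:
  assumes "continuous_on {T1..T2} N"
    and "alternating M N (Suc l) 0 T1" "alternating M N (Suc l) (Suc 0) T1"
  shows "alternating M N (Suc (Suc l)) 0 T1 \<or> alternating M N (Suc (Suc l)) (Suc 0) T1"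
proof -
  obtain t where t: "T1 < t" "t < T2" "M t > 0" "alternating M N l (Suc 0) t"
    using assms(2) by (auto simp: active_def)
  obtain s where s: "T1 < s" "s < T2" "N s > 0" "alternating M N l 0 s"
    using assms(3) by (auto simp: active_def alternating_parity)
  have later: "alternating M N (Suc (Suc l)) (Suc 0) T1" if "T1 < r" "r < t" "N r > 0" for r
  proof -
    have "alternating M N (Suc l) 0 r" using t that by (auto simp: active_def)
    then have "alternating M N (Suc l) (Suc (Suc 0)) r" by (simp only: alternating_parity)
    with t that show ?thesis by (subst alternating.simps) (auto simp: active_def)
  qed
  consider "t < s" | "s < t" | "s = t" by linarith
  then show ?thesis
  proof cases
    case 1
    have "alternating M N (Suc l) (Suc 0) t"
      using s 1 by (auto simp: active_def alternating_parity)
    with t have "alternating M N (Suc (Suc l)) 0 T1"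
      by (subst alternating.simps) (auto simp: active_def)
    then show ?thesis ..
  next
    case 2
    with later[of s] s show ?thesis by blast
  next
    case 3
    have "continuous (at t within {T1..T2}) N"
      using assms(1) t by (auto simp: continuous_on_eq_continuous_within)
    then have "isCont N t" using t at_within_Icc_at[of T1 t T2] by simp
    then have "\<forall>\<^sub>F r in at t. N r > 0"
      using s 3 by (auto simp: isCont_def intro: order_tendstoD)
    then have "\<forall>\<^sub>F r in at_left t. N r > 0" by (simp add: eventually_at_split)
    moreover have "\<forall>\<^sub>F r in at_left t. r \<in> {T1<..<t}"
      using t(1) by (rule eventually_at_left_real)
    ultimately obtain r where "N r > 0" "r \<in> {T1<..<t}"
      using eventually_happens'[OF trivial_limit_at_left_real] eventually_conj by blast
    with later[of r] show ?thesis by auto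
  qed
qed

text \<open>The path runs from the midpoint of band \<open>i\<close> to that of band
  \<open>i + k\<close>, and each of these \<open>k + 1\<close> bands contributes one point. The
  points are ordered because no multiple of pi is crossed back.\<close>

lemma alternating_of_neumann_angle:
  assumes "neumann_angle i k M N" "k \<ge> 1"
    and cont: "continuous_on {T1..T2} M" "continuous_on {T1..T2} N"
  shows "alternating M N (Suc k) i T1"
proof -
  obtain \<theta> where \<theta>: "prufer_angle M N \<theta>" "\<theta> T1 = real i * pi + pi / 2"
      "\<theta> T2 = real (i + k) * pi + pi / 2"
    using assms(1) by (auto simp: neumann_angle_def)
  \<comment> \<open>Induction on the number \<open>d\<close> of bands after band \<open>j\<close>.
    The condition on \<open>a\<close> ensures that the point found in band \<open>j\<close> lies to
    the right of \<open>a\<close>.\<close>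
  have "alternating M N (Suc d) j a"
    if "j + d = i + k" "i \<le> j" "T1 \<le> a" "a \<le> T2" "a = T1 \<or> \<theta> a \<le> real j * pi" for d j a
    using that
  proof (induction d arbitrary: j a)
    case (0 j a)
    note step = 0
    have "\<theta> T1 \<le> real j * pi + pi / 2" "real j * pi + pi / 2 \<le> \<theta> T2"
      unfolding \<theta>(2,3) using step by (auto intro!: mult_right_mono)
    then obtain t where t: "t \<in> {T1<..<T2}" "real j * pi < \<theta> t" "active M N j t > 0"
      using active_pos_in_band[OF \<theta>(1) cont, of j] \<theta>(2,3) \<open>k \<ge> 1\<close> by auto
    have "a < t"
    proof (rule ccontr)
      assume "\<not> a < t"
      then have "real j * pi < \<theta> a"
        using t step prufer_angle_above_strict[OF \<theta>(1) cont, of t a "real j * pi"]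
          sin_nat_pi[of j]
        by (cases "t = a") auto
      with step t \<open>\<not> a < t\<close> show False by auto
    qed
    with t show ?case by auto
  next
    case (Suc d j a)
    note step = Suc
    have "\<theta> T1 \<le> real j * pi + pi / 2" "real j * pi + pi / 2 \<le> \<theta> T2"
      unfolding \<theta>(2,3) using step by (auto intro!: mult_right_mono)
    then obtain t where t: "t \<in> {T1<..<T2}" "real j * pi < \<theta> t" "\<theta> t < real (Suc j) * pi"
        "active M N j t > 0"
      using active_pos_in_band[OF \<theta>(1) cont, of j] \<theta>(2,3) \<open>k \<ge> 1\<close> by auto
    have "a < t"
    proof (rule ccontr)
      assume "\<not> a < t"
      then have "real j * pi < \<theta> a"
        using t step prufer_angle_above_strict[OF \<theta>(1) cont, of t a "real j * pi"]
          sin_nat_pi[of j]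
        by (cases "t = a") auto
      with step t \<open>\<not> a < t\<close> show False by auto
    qed
    moreover have "alternating M N (Suc d) (Suc j) t"
      using step t by (intro step(1)) auto
    ultimately show ?case using t by (subst alternating.simps) auto
  qed
  from this[of i k T1] show ?thesis using T1_less_T2 by simp
qed

section \<open>Scaling both weights\<close>

lemma active_scale: "active (\<lambda>t. r * M t) (\<lambda>t. r * N t) j t = r * active M N j t"
  by (simp add: active_def)

text \<open>The first point of a chain is strictly to the right of its bound. This slack leaves room
  for a whole interval around the preceding point.\<close>

lemma alternating_shift:
  assumes "alternating M N l j t"
  obtains d where "d > 0" "\<And>e. e < d \<Longrightarrow> alternating M N l j (t + e)"
proof (cases l)
  case 0
  then show thesis by (intro that[of 1]) auto
next
  case (Suc l')
  with assms obtain s where s: "t < s" "s < T2" "active M N j s > 0" "alternating M N l' (Suc j) s"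
    by auto
  then show thesis using Suc by (intro that[of "s - t"]) (auto intro!: exI[of _ s])
qed

text \<open>Where the active weight is at least \<open>\<mu> > 0\<close>, the squeezed angle moves with speed of order
  \<open>sqrt r\<close>; hence it completes a half-turn in any given time once \<open>r\<close> is large.\<close>

lemma half_turn:
  assumes ab: "T1 \<le> a" "a < b" "b \<le> T2" and \<mu>: "\<mu> > 0"
    and cont: "continuous_on {T1..T2} M" "continuous_on {T1..T2} N"
    and lower: "\<And>t. t \<in> {a<..<b} \<Longrightarrow> active M N j t \<ge> \<mu>"
  obtains r0 where "\<And>r \<theta>. r \<ge> r0 \<Longrightarrow> prufer_angle (\<lambda>t. r * M t) (\<lambda>t. r * N t) \<theta> \<Longrightarrow>
    real j * pi \<le> \<theta> a \<Longrightarrow> real (Suc j) * pi \<le> \<theta> b"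
proof -
  obtain Q where Q: "Q \<ge> 0" "\<And>t. t \<in> {T1..T2} \<Longrightarrow> \<bar>q t\<bar> \<le> Q"
    using continuous_on_Icc_bound[OF cont_q] by metis
  obtain t0 where t0: "t0 \<in> {T1..T2}" "\<And>t. t \<in> {T1..T2} \<Longrightarrow> P t0 \<le> P t"
    using continuous_attains_inf[OF compact_Icc _ cont_P] T1_less_T2 by auto
  define P0 where "P0 = P t0"
  have P0: "P0 > 0" using P_pos[OF t0(1)] by (simp add: P0_def)
  \<comment> \<open>\<open>\<omega>\<close> is the constant speed that makes one half-turn in time
    \<open>b - a\<close>. \<open>K\<close> and \<open>c\<close> satisfy \<open>c^2 * K = P0\<close>
    and \<open>c * K = \<omega>\<close>, so that the lower bound
    \<open>P0 * cos^2 + K * sin^2\<close> for the speed turns, after squeezing, into exactly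
    \<open>\<omega>\<close>.\<close>
  define \<omega> where "\<omega> = pi / (b - a)"
  have \<omega>: "\<omega> > 0" "\<omega> * (b - a) = pi" using ab by (auto simp: \<omega>_def)
  define K where "K = \<omega>\<^sup>2 / P0"
  have K: "K > 0" using \<omega> P0 by (simp add: K_def)
  define c where "c = P0 / \<omega>"
  have c: "c > 0" using \<omega> P0 by (simp add: c_def)
  have cK: "c\<^sup>2 * K = P0" "c * K = \<omega>"
    using \<omega> P0 by (auto simp: c_def K_def field_simps power2_eq_square)
  show thesis
  \<comment> \<open>From this threshold on, \<open>r\<close> times the active weight exceeds
    \<open>q\<close> by at least \<open>K\<close>.\<close>
  proof (rule that[of "(Q + K) / \<mu>"])
    fix r \<theta>
    assume r: "r \<ge> (Q + K) / \<mu>" and \<theta>: "prufer_angle (\<lambda>t. r * M t) (\<lambda>t. r * N t) \<theta>"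
      and start: "real j * pi \<le> \<theta> a"
    have r\<mu>: "r * \<mu> \<ge> Q + K" using r \<mu> by (simp add: field_simps)
    have "(Q + K) / \<mu> \<ge> 0" using Q K \<mu> by simp
    then have "r \<ge> 0" using r by linarith
    have cont': "continuous_on {T1..T2} (\<lambda>t. r * M t)" "continuous_on {T1..T2} (\<lambda>t. r * N t)"
      by (intro continuous_intros cont)+
    show "real (Suc j) * pi \<le> \<theta> b"
    proof (rule ccontr)
      assume "\<not> real (Suc j) * pi \<le> \<theta> b"
      then have stop: "\<theta> b < real (Suc j) * pi" by simp
      have band: "real j * pi < \<theta> t \<and> \<theta> t < real (Suc j) * pi" if "t \<in> {a<..<b}" for t
      proof
        show "real j * pi < \<theta> t"
          using that ab start sin_nat_pi[of j]
          by (intro prufer_angle_above_strict[OF \<theta> cont', of a]) auto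
        show "\<theta> t < real (Suc j) * pi"
        proof (rule ccontr)
          assume "\<not> \<theta> t < real (Suc j) * pi"
          then have "real (Suc j) * pi \<le> \<theta> b"
            using that ab sin_nat_pi[of "Suc j"]
            by (intro prufer_angle_above[OF \<theta> cont', of t b "real (Suc j) * pi"])
              (auto simp del: of_nat_Suc)
          with stop show False by simp
        qed
      qed
      \<comment> \<open>Monotonicity of \<open>f\<close> gives the squeezed angle a gain of at least
        \<open>pi\<close>. Since squeezing fixes multiples of pi, the angle could not have stayed
        below \<open>Suc j * pi\<close>.\<close>
      define f where "f = (\<lambda>t. squeeze c (\<theta> t) - \<omega> * t)"
      have "f a \<le> f b"
      proof (rule DERIV_nonneg_imp_increasing_open[of a b f])
        show "continuous_on {a..b} f"
          unfolding f_def
          by (intro continuous_intros continuous_on_compose2[OF continuous_on_squeeze[OF c]]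
              prufer_angle_continuous[OF \<theta>]) (use ab in auto)
        fix t assume "a < t" "t < b"
        then have t: "t \<in> {a<..<b}" "t \<in> {T1..T2}" "t \<in> {T1<..<T2}" using ab by auto
        let ?s = "sin (\<theta> t)" and ?k = "cos (\<theta> t)"
        let ?v = "speed (\<lambda>t. r * M t) (\<lambda>t. r * N t) t (\<theta> t)"
        define w where "w = ?s\<^sup>2 + c\<^sup>2 * ?k\<^sup>2"
        have w: "w > 0" unfolding w_def by (rule squeeze_denominators[OF c])
        have d: "(f has_real_derivative c / w * ?v - \<omega>) (at t)"
          unfolding f_def w_def
          by (intro DERIV_diff DERIV_chain2[OF DERIV_squeeze[OF c]] prufer_angle_deriv[OF \<theta> t(3)])
            (auto intro!: derivative_eq_intros)
        have "r * \<mu> \<le> r * active M N j t" using lower[OF t(1)] \<open>r \<ge> 0\<close> by (intro mult_left_mono)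
        then have "K \<le> active (\<lambda>t. r * M t) (\<lambda>t. r * N t) j t - q t"
          using r\<mu> Q(2)[OF t(2)] unfolding active_scale by linarith
        then have "P0 * ?k\<^sup>2 + K * ?s\<^sup>2 \<le> ?v"
          using t0(2)[OF t(2)] band[OF t(1)]
          by (simp only: speed_band[of j] P0_def) (intro add_mono mult_right_mono, auto)
        moreover have "P0 * ?k\<^sup>2 + K * ?s\<^sup>2 = K * w"
          unfolding w_def cK(1)[symmetric] by (simp add: algebra_simps)
        ultimately have "c / w * (K * w) \<le> c / w * ?v"
          using c w by (intro mult_left_mono) auto
        moreover have "c / w * (K * w) = \<omega>" using w cK(2) by simp
        ultimately show "\<exists>y. (f has_real_derivative y) (at t) \<and> y \<ge> 0"
          using d by (intro exI[of _ "c / w * ?v - \<omega>"]) auto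
      qed (use ab in auto)
      then have "squeeze c (\<theta> a) + \<omega> * (b - a) \<le> squeeze c (\<theta> b)"
        by (simp add: f_def algebra_simps)
      moreover have "real j * pi \<le> squeeze c (\<theta> a)"
        using squeeze_mono[OF c start] by (simp add: squeeze_fixed sin_nat_pi)
      moreover have "squeeze c (\<theta> b) < real (Suc j) * pi"
        using squeeze_strict_mono[OF c stop] squeeze_fixed[of "real (Suc j) * pi" c]
          sin_nat_pi[of "Suc j"] by simp
      ultimately show False using \<omega>(2) by (simp add: algebra_simps)
    qed
  qed
qed

text \<open>Induction along the chain: a short interval around each point, where the active weight
  exceeds half its value at that point, provides one half-turn, and the thresholds for
  \<open>r\<close> are combined by a maximum.\<close>

lemma alternating_imp_many_turns:
  assumes cont: "continuous_on {T1..T2} M" "continuous_on {T1..T2} N"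
  shows "alternating M N l j a \<Longrightarrow> T1 \<le> a \<Longrightarrow> a \<le> T2 \<Longrightarrow>
    \<exists>r0. \<forall>r\<ge>r0. \<forall>\<theta>. prufer_angle (\<lambda>t. r * M t) (\<lambda>t. r * N t) \<theta> \<longrightarrow>
      real j * pi \<le> \<theta> a \<longrightarrow> real (j + l) * pi \<le> \<theta> T2"
proof (induction l arbitrary: j a)
  case 0
  have "real j * pi \<le> \<theta> T2"
    if "prufer_angle (\<lambda>t. r * M t) (\<lambda>t. r * N t) \<theta>" "real j * pi \<le> \<theta> a" for r \<theta>
    by (rule prufer_angle_above[OF that(1), of a])
      (use 0 that cont sin_nat_pi[of j] in \<open>auto intro!: continuous_intros\<close>)
  then show ?case by auto
next
  case (Suc l)
  then obtain t where t: "a < t" "t < T2" "active M N j t > 0" "alternating M N l (Suc j) t"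
    by auto
  obtain d where d: "d > 0" "\<And>e. e < d \<Longrightarrow> alternating M N l (Suc j) (t + e)"
    using alternating_shift[OF t(4)] by blast
  define \<mu> where "\<mu> = active M N j t / 2"
  have "continuous_on {T1..T2} (active M N j)" using cont by (simp add: active_def)
  then have "continuous (at t within {T1..T2}) (active M N j)"
    using t Suc.prems by (auto simp: continuous_on_eq_continuous_within)
  then have "isCont (active M N j) t" using t Suc.prems at_within_Icc_at[of T1 t T2] by simp
  moreover have "\<mu> < active M N j t" using t(3) by (simp add: \<mu>_def)
  ultimately have "\<forall>\<^sub>F s in at t. \<mu> < active M N j s"
    unfolding isCont_def by (rule order_tendstoD(1))
  then obtain e where e: "e > 0" "\<And>s. s \<noteq> t \<Longrightarrow> dist s t < e \<Longrightarrow> \<mu> < active M N j s"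
    unfolding eventually_at by auto
  \<comment> \<open>Small enough for the weight to stay above \<open>\<mu>\<close>, for the
    remaining chain to start after \<open>t + h\<close>, and for the interval to lie between
    \<open>a\<close> and \<open>T2\<close>. Halving \<open>d\<close> makes \<open>h < d\<close>
    strict.\<close>
  define h where "h = Min {e, d / 2, t - a, T2 - t}"
  have h: "h > 0" "h \<le> e" "h < d" "a \<le> t - h" "t + h \<le> T2"
  proof -
    have "h \<le> e" "h \<le> d / 2" "h \<le> t - a" "h \<le> T2 - t" unfolding h_def by (intro Min_le; simp)+
    then show "h \<le> e" "h < d" "a \<le> t - h" "t + h \<le> T2" using d(1) by auto
    show "h > 0" using e(1) d(1) t by (simp add: h_def)
  qed
  have "active M N j s \<ge> \<mu>" if "s \<in> {t - h<..<t + h}" for s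
  proof (cases "s = t")
    case False
    have "dist s t < e" using that h(2) by (auto simp: dist_real_def)
    with e(2)[OF False] show ?thesis by simp
  qed (use t(3) in \<open>simp add: \<mu>_def\<close>)
  then obtain r1 where r1: "\<And>r \<theta>. r \<ge> r1 \<Longrightarrow> prufer_angle (\<lambda>t. r * M t) (\<lambda>t. r * N t) \<theta> \<Longrightarrow>
      real j * pi \<le> \<theta> (t - h) \<Longrightarrow> real (Suc j) * pi \<le> \<theta> (t + h)"
    using half_turn[of "t - h" "t + h" \<mu> M N j] cont h t Suc.prems by (auto simp: \<mu>_def)
  obtain r2 where r2: "\<And>r \<theta>. r \<ge> r2 \<Longrightarrow> prufer_angle (\<lambda>t. r * M t) (\<lambda>t. r * N t) \<theta> \<Longrightarrow>
      real (Suc j) * pi \<le> \<theta> (t + h) \<Longrightarrow> real (Suc j + l) * pi \<le> \<theta> T2"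
    using Suc.IH[of "Suc j" "t + h"] d(2)[OF h(3)] h t Suc.prems by auto
  have "real (j + Suc l) * pi \<le> \<theta> T2"
    if "r \<ge> max r1 r2" "prufer_angle (\<lambda>t. r * M t) (\<lambda>t. r * N t) \<theta>" "real j * pi \<le> \<theta> a" for r \<theta>
  proof -
    have c: "continuous_on {T1..T2} (\<lambda>t. r * M t)" "continuous_on {T1..T2} (\<lambda>t. r * N t)"
      by (intro continuous_intros cont)+
    have "real j * pi \<le> \<theta> (t - h)"
      by (rule prufer_angle_above[OF that(2) c _ h(4)]) (use that h t Suc.prems sin_nat_pi in auto)
    from r2[OF _ that(2) r1[OF _ that(2) this]] that(1) show ?thesis by simp
  qed
  then show ?case by blast
qed

text \<open>Changing the scale from \<open>r\<close> to \<open>s\<close> perturbs the speed by at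
  most a multiple of \<open>\<bar>s - r\<bar>\<close>, and Gronwall carries this to a Lipschitz-type
  bound at \<open>T2\<close>.\<close>

lemma prufer_angle_scale_continuous:
  assumes cont: "continuous_on {T1..T2} M" "continuous_on {T1..T2} N"
    and \<theta>: "prufer_angle (\<lambda>t. r * M t) (\<lambda>t. r * N t) \<theta>"
  obtains C where "C > 0"
    "\<And>s \<phi>. prufer_angle (\<lambda>t. s * M t) (\<lambda>t. s * N t) \<phi> \<Longrightarrow> \<phi> T1 = \<theta> T1 \<Longrightarrow>
      \<bar>\<phi> T2 - \<theta> T2\<bar> \<le> C * \<bar>s - r\<bar>"
proof -
  have contr: "continuous_on {T1..T2} (\<lambda>t. r * M t)" "continuous_on {T1..T2} (\<lambda>t. r * N t)"
    by (intro continuous_intros cont)+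
  let ?F = "\<lambda>s. speed (\<lambda>t. s * M t) (\<lambda>t. s * N t)"
  obtain L where L: "L > 0"
    "\<And>t x y. t \<in> {T1..T2} \<Longrightarrow> \<bar>?F r t x - ?F r t y\<bar> \<le> L * \<bar>x - y\<bar>"
    using speed_lipschitz[OF contr] by metis
  obtain BM where BM: "BM \<ge> 0" "\<And>t. t \<in> {T1..T2} \<Longrightarrow> \<bar>M t\<bar> \<le> BM"
    using continuous_on_Icc_bound[OF cont(1)] by metis
  obtain BN where BN: "BN \<ge> 0" "\<And>t. t \<in> {T1..T2} \<Longrightarrow> \<bar>N t\<bar> \<le> BN"
    using continuous_on_Icc_bound[OF cont(2)] by metis
  define K where "K = BM + BN + 1"
  define C where "C = K * exp ((2 * L + 1) * (T2 - T1) / 2)"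
  have K: "K > 0" using BM BN by (simp add: K_def)
  show thesis
  proof (rule that[of C])
    show "C > 0" using K by (simp add: C_def)
    fix s \<phi>
    assume \<phi>: "prufer_angle (\<lambda>t. s * M t) (\<lambda>t. s * N t) \<phi>" and init: "\<phi> T1 = \<theta> T1"
    define \<kappa> where "\<kappa> = K * \<bar>s - r\<bar>"
    have \<kappa>: "\<kappa> \<ge> 0" using K by (simp add: \<kappa>_def)
    \<comment> \<open>Adding the constant \<open>\<kappa>^2\<close> absorbs the perturbation, so
      that a homogeneous Gronwall inequality suffices. As \<open>E\<close> is quadratic, the
      exponent in \<open>C\<close> is halved.\<close>
    define E where "E = (\<lambda>t. (\<phi> t - \<theta> t)\<^sup>2 + \<kappa>\<^sup>2)"
    have "E T2 \<le> E T1 * exp ((2 * L + 1) * (T2 - T1))"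
    proof (rule gronwall_exceptional[OF finite.emptyI])
      show "continuous_on {T1..T2} E"
        unfolding E_def
        by (intro continuous_intros prufer_angle_continuous[OF \<theta>] prufer_angle_continuous[OF \<phi>]) auto
      show "T2 \<in> {T1..T2}" using T1_less_T2 by simp
      fix t assume "t \<in> {T1<..<T2} - {}"
      then have t: "t \<in> {T1<..<T2}" "t \<in> {T1..T2}" by auto
      let ?x = "\<phi> t - \<theta> t" and ?d = "?F s t (\<phi> t) - ?F r t (\<theta> t)"
      have "(E has_real_derivative 2 * ?x * ?d) (at t)"
        unfolding E_def
        by (auto intro!: derivative_eq_intros prufer_angle_deriv[OF \<theta> t(1)]
            prufer_angle_deriv[OF \<phi> t(1)])
      moreover have "2 * ?x * ?d \<le> (2 * L + 1) * E t"
      proof -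
        have "\<bar>?F s t (\<phi> t) - ?F r t (\<phi> t)\<bar> \<le> \<bar>s * M t - r * M t\<bar> + \<bar>s * N t - r * N t\<bar>"
          by (rule speed_weight_diff)
        also have "\<dots> = \<bar>s - r\<bar> * (\<bar>M t\<bar> + \<bar>N t\<bar>)"
          by (simp add: abs_mult distrib_left flip: left_diff_distrib)
        also have "\<dots> \<le> \<bar>s - r\<bar> * K"
          using BM(2)[OF t(2)] BN(2)[OF t(2)] by (intro mult_left_mono) (auto simp: K_def)
        finally have 1: "\<bar>?F s t (\<phi> t) - ?F r t (\<phi> t)\<bar> \<le> \<kappa>" by (simp add: \<kappa>_def mult.commute)
        have "\<bar>?d\<bar> \<le> \<kappa> + L * \<bar>?x\<bar>" using 1 L(2)[OF t(2), of "\<phi> t" "\<theta> t"] by linarith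
        then have "2 * \<bar>?x\<bar> * \<bar>?d\<bar> \<le> 2 * \<bar>?x\<bar> * (\<kappa> + L * \<bar>?x\<bar>)" by (intro mult_left_mono) auto
        also have "\<dots> = 2 * \<bar>?x\<bar> * \<kappa> + 2 * L * ?x\<^sup>2"
          by (simp add: algebra_simps power2_eq_square)
        also have "2 * \<bar>?x\<bar> * \<kappa> \<le> ?x\<^sup>2 + \<kappa>\<^sup>2" using sum_squares_bound[of "\<bar>?x\<bar>" \<kappa>] by simp
        also have "?x\<^sup>2 + \<kappa>\<^sup>2 + 2 * L * ?x\<^sup>2 \<le> (2 * L + 1) * E t"
          using L(1) by (simp add: E_def algebra_simps)
        finally have "2 * \<bar>?x\<bar> * \<bar>?d\<bar> \<le> (2 * L + 1) * E t" by simp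
        moreover have "2 * ?x * ?d \<le> 2 * \<bar>?x\<bar> * \<bar>?d\<bar>"
          by (rule order_trans[OF abs_ge_self]) (simp only: abs_mult abs_numeral order_refl)
        ultimately show ?thesis by linarith
      qed
      ultimately show "\<exists>d. (E has_real_derivative d) (at t) \<and> d \<le> (2 * L + 1) * E t" by blast
    qed
    also have "E T1 = \<kappa>\<^sup>2" by (simp add: E_def init)
    also have "\<kappa>\<^sup>2 * exp ((2 * L + 1) * (T2 - T1)) = (C * \<bar>s - r\<bar>)\<^sup>2"
      by (simp add: \<kappa>_def C_def power_mult_distrib flip: exp_double)
    finally have "(\<phi> T2 - \<theta> T2)\<^sup>2 \<le> (C * \<bar>s - r\<bar>)\<^sup>2"
      unfolding E_def by (smt (verit) zero_le_power2)
    moreover have "C * \<bar>s - r\<bar> \<ge> 0" using K by (simp add: C_def)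
    ultimately show "\<bar>\<phi> T2 - \<theta> T2\<bar> \<le> C * \<bar>s - r\<bar>" by (metis abs_le_square_iff abs_of_nonneg)
  qed
qed

text \<open>The final angle depends continuously on the scale, lies at or below the target for scale
  0 and at or above it for scale \<open>r\<close>; the intermediate value theorem gives
  \<open>s\<close>.\<close>

lemma neumann_angle_scale:
  assumes cont: "continuous_on {T1..T2} M" "continuous_on {T1..T2} N"
    and \<theta>: "prufer_angle (\<lambda>t. r * M t) (\<lambda>t. r * N t) \<theta>" and "r \<ge> 0"
    and ends: "\<theta> T1 = real i * pi + pi / 2" "real (i + k) * pi + pi / 2 \<le> \<theta> T2"
  obtains s where "s \<ge> 0" "neumann_angle i k (\<lambda>t. s * M t) (\<lambda>t. s * N t)"
proof -
  let ?c = "real i * pi + pi / 2" and ?e = "real (i + k) * pi + pi / 2"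
  have cont': "continuous_on {T1..T2} (\<lambda>t. s * M t)" "continuous_on {T1..T2} (\<lambda>t. s * N t)" for s
    by (intro continuous_intros cont)+
  have "\<exists>\<phi>. prufer_angle (\<lambda>t. s * M t) (\<lambda>t. s * N t) \<phi> \<and> \<phi> T1 = ?c" for s
    using prufer_angle_exists[OF cont'] by metis
  then obtain \<Phi> where \<Phi>: "\<And>s. prufer_angle (\<lambda>t. s * M t) (\<lambda>t. s * N t) (\<Phi> s)" "\<And>s. \<Phi> s T1 = ?c"
    by metis
  have "\<Phi> 0 T2 \<le> ?c"
  proof -
    obtain L where "\<And>t x y. t \<in> {T1..T2} \<Longrightarrow>
        \<bar>speed (\<lambda>t. 0 * M t) (\<lambda>t. 0 * N t) t x - speed (\<lambda>t. 0 * M t) (\<lambda>t. 0 * N t) t y\<bar> \<le> L * \<bar>x - y\<bar>"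
      using speed_lipschitz[OF cont'] by metis
    then show ?thesis
    proof (intro comparison_weak[of "{}" T1 T2 "\<Phi> 0" "\<lambda>_. ?c"
          "speed (\<lambda>t. 0 * M t) (\<lambda>t. 0 * N t)" L T2])
      show "continuous_on {T1..T2} (\<Phi> 0)" by (rule prufer_angle_continuous[OF \<Phi>(1)]) auto
      fix t assume t: "t \<in> {T1<..<T2} - {}"
      then show "\<exists>d. (\<Phi> 0 has_real_derivative d) (at t) \<and>
          d \<le> speed (\<lambda>t. 0 * M t) (\<lambda>t. 0 * N t) t (\<Phi> 0 t)"
        using prufer_angle_deriv[OF \<Phi>(1), of t 0] by blast
      show "\<exists>d. ((\<lambda>_. ?c) has_real_derivative d) (at t) \<and>
          speed (\<lambda>t. 0 * M t) (\<lambda>t. 0 * N t) t ?c \<le> d"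
        using t q_nonneg[of t]
        by (intro exI[of _ 0]) (simp add: speed_alt cos_odd_multiple sin_odd_multiple)
    qed (use T1_less_T2 \<Phi>(2) in auto)
  qed
  also have "?c \<le> ?e" by (simp add: algebra_simps)
  finally have 0: "\<Phi> 0 T2 \<le> ?e" .
  have "\<theta> T2 \<le> \<Phi> r T2"
    by (rule prufer_angle_mono[OF \<theta> \<Phi>(1) cont']) (use T1_less_T2 ends \<Phi>(2) in auto)
  with ends have 1: "?e \<le> \<Phi> r T2" by simp
  have "continuous_on {0..r} (\<lambda>s. \<Phi> s T2)"
    unfolding continuous_on_iff
  proof (intro ballI allI impI)
    fix x \<epsilon> :: real assume "\<epsilon> > 0"
    obtain C where C: "C > 0" "\<And>s. \<bar>\<Phi> s T2 - \<Phi> x T2\<bar> \<le> C * \<bar>s - x\<bar>"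
      using prufer_angle_scale_continuous[OF cont \<Phi>(1)[of x]] \<Phi> by metis
    have "dist (\<Phi> s T2) (\<Phi> x T2) < \<epsilon>" if "dist s x < \<epsilon> / C" for s
    proof -
      have "C * \<bar>s - x\<bar> < \<epsilon>" using that C(1) by (simp add: dist_real_def field_simps)
      with C(2)[of s] show ?thesis by (simp add: dist_real_def)
    qed
    with C(1) \<open>\<epsilon> > 0\<close>
    show "\<exists>d>0. \<forall>x'\<in>{0..r}. dist x' x < d \<longrightarrow> dist (\<Phi> x' T2) (\<Phi> x T2) < \<epsilon>"
      by (intro exI[of _ "\<epsilon> / C"]) auto
  qed
  from IVT'[OF 0 1 \<open>r \<ge> 0\<close> this] obtain s where "0 \<le> s" "\<Phi> s T2 = ?e" by auto
  then show thesis using \<Phi> by (intro that[of s]) (auto simp: neumann_angle_def)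
qed

lemma neumann_angle_of_alternating:
  assumes cont: "continuous_on {T1..T2} M" "continuous_on {T1..T2} N"
    and "alternating M N (Suc k) i T1"
  obtains s where "s \<ge> 0" "neumann_angle i k (\<lambda>t. s * M t) (\<lambda>t. s * N t)"
proof -
  obtain r0 where r0: "\<And>r \<theta>. r \<ge> r0 \<Longrightarrow> prufer_angle (\<lambda>t. r * M t) (\<lambda>t. r * N t) \<theta> \<Longrightarrow>
      real i * pi \<le> \<theta> T1 \<Longrightarrow> real (i + Suc k) * pi \<le> \<theta> T2"
    using alternating_imp_many_turns[OF cont assms(3)] T1_less_T2 by auto
  define r where "r = max r0 0"
  have cont': "continuous_on {T1..T2} (\<lambda>t. r * M t)" "continuous_on {T1..T2} (\<lambda>t. r * N t)"
    by (intro continuous_intros cont)+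
  obtain \<theta> where \<theta>: "prufer_angle (\<lambda>t. r * M t) (\<lambda>t. r * N t) \<theta>" "\<theta> T1 = real i * pi + pi / 2"
    using prufer_angle_exists[OF cont'] by metis
  have "real (i + Suc k) * pi \<le> \<theta> T2" using r0[OF _ \<theta>(1)] \<theta>(2) by (simp add: r_def)
  moreover have "real (i + Suc k) * pi = real (i + k) * pi + pi" by (simp add: algebra_simps)
  \<comment> \<open>Reaching \<open>(i + k + 1) * pi\<close> overshoots the target by
    \<open>pi / 2\<close>.\<close>
  ultimately have "real (i + k) * pi + pi / 2 \<le> \<theta> T2" using pi_gt_zero by linarith
  from neumann_angle_scale[OF cont \<theta>(1) _ \<theta>(2) this] that show thesis by (auto simp: r_def)
qed

text \<open>The two angles interlace: each stays strictly between the other one and its translate by \<open>2 pi\<close>.\<close>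

lemma other_angle_far:
  assumes cont: "continuous_on {T1..T2} M" "continuous_on {T1..T2} N"
    and \<phi>: "prufer_angle M N \<phi>" "\<phi> T1 = real j * pi + pi / 2"
      "real (j + Suc k) * pi + pi / 2 \<le> \<phi> T2"
    and \<theta>: "prufer_angle M N \<theta>" "\<theta> T1 = real i * pi + pi / 2"
    and ij: "i \<in> {0, 1}" "j \<in> {0, 1}"
  shows "real (i + k) * pi + pi / 2 < \<theta> T2"
proof -
  have T2: "T2 \<in> {T1..T2}" using T1_less_T2 by simp
  have pi: "pi > 0" by simp
  \<comment> \<open>Equal starts leave a spare half-turn. For different starts the end levels match
    exactly, up to the translation by \<open>2 * pi\<close>, and strictness comes from the order of
    the initial values.\<close>
  consider "i = j" | "j = 0" "i = 1" | "j = 1" "i = 0" using ij by auto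
  then show ?thesis
  proof cases
    case 1
    then have "\<phi> T2 \<le> \<theta> T2"
      using \<theta> \<phi> by (intro prufer_angle_mono[OF \<phi>(1) \<theta>(1) cont _ T2]) simp
    moreover have "real (j + Suc k) * pi = real (i + k) * pi + pi"
      using 1 by (simp add: algebra_simps)
    ultimately show ?thesis using \<phi>(3) pi by linarith
  next
    case 2
    have "\<phi> T1 < \<theta> T1" unfolding \<phi>(2) \<theta>(2) using 2 pi by simp
    then have "\<phi> T2 < \<theta> T2" by (rule prufer_angle_strict_mono[OF \<phi>(1) \<theta>(1) cont _ T2])
    moreover have "real (j + Suc k) * pi = real (i + k) * pi"
      using 2 by (simp add: algebra_simps)
    ultimately show ?thesis using \<phi>(3) by linarith
  next
    case 3
    have "\<phi> T1 < \<theta> T1 + 2 * pi" unfolding \<phi>(2) \<theta>(2) using 3 pi by simp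
    then have "\<phi> T2 < \<theta> T2 + 2 * pi"
      by (rule prufer_angle_strict_mono[OF \<phi>(1) prufer_angle_shift[OF \<theta>(1)] cont _ T2])
    moreover have "real (j + Suc k) * pi = real (i + k) * pi + 2 * pi"
      using 3 by (simp add: algebra_simps)
    ultimately show ?thesis using \<phi>(3) by linarith
  qed
qed

text \<open>Enlarging the weight to \<open>c * N\<close> keeps at least \<open>k + 1\<close>
  half-turns for the start \<open>j\<close>. Interlacing then forces more than \<open>k\<close>
  half-turns for the start \<open>i\<close>.\<close>

lemma neumann_angle_weight_contradiction:
  assumes cont: "continuous_on {T1..T2} M" "continuous_on {T1..T2} N" and "c \<ge> 1"
    and larger: "neumann_angle i k M (\<lambda>t. c * N t)" and smaller: "neumann_angle j (Suc k) M N"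
    and ij: "i \<in> {0, 1}" "j \<in> {0, 1}"
  shows False
proof -
  have contc: "continuous_on {T1..T2} (\<lambda>t. c * N t)" by (intro continuous_intros cont)
  obtain \<theta> where \<theta>: "prufer_angle M (\<lambda>t. c * N t) \<theta>" "\<theta> T1 = real i * pi + pi / 2"
      "\<theta> T2 = real (i + k) * pi + pi / 2"
    using larger by (auto simp: neumann_angle_def)
  obtain \<psi> where \<psi>: "prufer_angle M N \<psi>" "\<psi> T1 = real j * pi + pi / 2"
      "\<psi> T2 = real (j + Suc k) * pi + pi / 2"
    using smaller by (auto simp: neumann_angle_def)
  obtain \<phi> where \<phi>: "prufer_angle M (\<lambda>t. c * N t) \<phi>" "\<phi> T1 = real j * pi + pi / 2"
    using prufer_angle_exists[OF cont(1) contc] by metis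
  have "\<psi> T2 \<le> \<phi> T2"
  proof (rule prufer_angle_weight_mono[OF \<psi>(1) \<phi>(1) \<open>c \<ge> 1\<close> cont])
    show "finite {t \<in> {T1<..<T2}. sin (\<psi> t) = 0}" by (rule prufer_angle_zeros[OF \<psi>(1) cont \<psi>(2,3)])
  qed (simp_all only: \<psi>(2,3) \<phi>(2) cos_odd_multiple)
  then have "real (j + Suc k) * pi + pi / 2 \<le> \<phi> T2" by (simp only: \<psi>(3))
  from other_angle_far[OF cont(1) contc \<phi> this \<theta>(1,2) ij] \<theta>(3) show False by simp
qed

end

section \<open>Transfer to the sets \<open>C_gt\<close> and \<open>C_lt\<close>\<close>

context neumann_problem
begin

text \<open>As \<open>i\<close> runs through 0 and 1, the parity of \<open>i + k\<close> takes each
  value once; so both sets correspond to all \<open>i\<close>, and one of them to some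
  \<open>i\<close>.\<close>

lemma pairs_iff_neumann_angle:
  "C_gt T1 T2 p q m n k \<inter> Q \<noteq> {} \<and> C_lt T1 T2 p q m n k \<inter> Q \<noteq> {} \<longleftrightarrow>
    (\<forall>i\<in>{0, 1}. \<exists>(a, b)\<in>Q. neumann_angle i k (wm a) (wn b))" (is ?both)
  "C_gt T1 T2 p q m n k \<inter> Q \<noteq> {} \<or> C_lt T1 T2 p q m n k \<inter> Q \<noteq> {} \<longleftrightarrow>
    (\<exists>i\<in>{0, 1}. \<exists>(a, b)\<in>Q. neumann_angle i k (wm a) (wn b))" (is ?one)
proof -
  have gt: "C_gt T1 T2 p q m n k \<inter> Q \<noteq> {} \<longleftrightarrow>
      (\<exists>i\<in>{0, 1}. even (i + k) \<and> (\<exists>(a, b)\<in>Q. neumann_angle i k (wm a) (wn b)))"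
    using mem_C_gt_iff[of _ _ k] by fast
  have lt: "C_lt T1 T2 p q m n k \<inter> Q \<noteq> {} \<longleftrightarrow>
      (\<exists>i\<in>{0, 1}. odd (i + k) \<and> (\<exists>(a, b)\<in>Q. neumann_angle i k (wm a) (wn b)))"
    using mem_C_lt_iff[of _ _ k] by fast
  show ?both ?one unfolding gt lt by (cases "even k"; auto)+
qed

lemma neumann_angle_of_mem:
  assumes "C \<in> {C_gt T1 T2 p q m n k, C_lt T1 T2 p q m n k}" "(a, b) \<in> C"
  obtains i where "i \<in> {0, 1}" "neumann_angle i k (wm a) (wn b)"
proof -
  have "\<exists>i\<in>{0, 1}. neumann_angle i k (wm a) (wn b)"
    using assms by (auto simp: mem_C_gt_iff mem_C_lt_iff)
  then show thesis using that by blast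
qed

lemma neumann_angle_between:
  assumes cone: "\<And>r a b. r \<ge> 0 \<Longrightarrow> (a, b) \<in> Q \<Longrightarrow> (r * a, r * b) \<in> Q"
    and "(a, b) \<in> Q" "neumann_angle j (Suc k) (wm a) (wn b)" "j \<in> {0, 1}" "i \<in> {0, 1}"
  shows "\<exists>(a, b)\<in>Q. neumann_angle i k (wm a) (wn b)"
proof -
  obtain \<phi> where \<phi>: "prufer_angle (wm a) (wn b) \<phi>" "\<phi> T1 = real j * pi + pi / 2"
      "\<phi> T2 = real (j + Suc k) * pi + pi / 2"
    using assms(3) by (auto simp: neumann_angle_def)
  obtain \<theta> where \<theta>: "prufer_angle (wm a) (wn b) \<theta>" "\<theta> T1 = real i * pi + pi / 2"
    using prufer_angle_exists[OF cont_weights] by metis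
  have "real (i + k) * pi + pi / 2 \<le> \<theta> T2"
    using other_angle_far[OF cont_weights \<phi>(1,2) _ \<theta> assms(5,4)] \<phi>(3) by (auto simp: less_imp_le)
  moreover have "prufer_angle (\<lambda>t. 1 * wm a t) (\<lambda>t. 1 * wn b t) \<theta>" using \<theta>(1) by simp
  ultimately obtain s where s: "s \<ge> 0" "neumann_angle i k (\<lambda>t. s * wm a t) (\<lambda>t. s * wn b t)"
    using neumann_angle_scale[where M = "wm a" and N = "wn b" and r = 1 and \<theta> = \<theta> and i = i and k = k]
      cont_weights \<theta>(2) zero_le_one by metis
  then have "neumann_angle i k (wm (s * a)) (wn (s * b))" by (simp add: mult.assoc)
  with cone[OF s(1) assms(2)] show ?thesis by blast
qed

text \<open>The solutions for \<open>i = 0\<close> and \<open>i = 1\<close> may belong to different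
  pairs \<open>(a, b)\<close>. Positivity of \<open>a * m t\<close> in the given quadrant implies
  positivity of \<open>\<sigma>1 * m t\<close>, and likewise for \<open>n\<close>, so both chains
  become chains for the same weights and can be combined.\<close>

lemma neumann_angle_next:
  assumes sgn: "\<sigma>1 \<in> {1, -1}" "\<sigma>2 \<in> {1, -1}" and "k \<ge> 1"
    and na: "\<And>i. i \<in> {0, 1} \<Longrightarrow>
      \<exists>a b. \<sigma>1 * a \<ge> 0 \<and> \<sigma>2 * b \<ge> 0 \<and> neumann_angle i k (wm a) (wn b)"
  obtains i s where "i \<in> {0, 1}" "s \<ge> 0" "neumann_angle i (Suc k) (wm (s * \<sigma>1)) (wn (s * \<sigma>2))"
proof -
  have alt: "alternating (wm \<sigma>1) (wn \<sigma>2) (Suc k) i T1" if i: "i \<in> {0, 1}" for i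
  proof -
    obtain a b where ab: "\<sigma>1 * a \<ge> 0" "\<sigma>2 * b \<ge> 0" "neumann_angle i k (wm a) (wn b)"
      using na[OF i] by blast
    have pos: "\<sigma> * x > 0" if "\<sigma> * c \<ge> 0" "c * x > 0" "\<sigma> \<in> {1, -1}" for \<sigma> c x :: real
      using that by (auto simp: zero_less_mult_iff mult_less_0_iff)
    have "active (wm \<sigma>1) (wn \<sigma>2) j t > 0" if "active (wm a) (wn b) j t > 0" for j t
      using that pos[OF ab(1) _ sgn(1)] pos[OF ab(2) _ sgn(2)]
      by (auto simp: active_def split: if_splits)
    then show ?thesis
      by (rule alternating_mono)
        (use alternating_of_neumann_angle[OF ab(3) \<open>k \<ge> 1\<close> cont_weights] in auto)
  qed
  have "\<exists>i\<in>{0, 1}. alternating (wm \<sigma>1) (wn \<sigma>2) (Suc (Suc k)) i T1"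
    using alternating_prepend[OF cont_weights(2) alt alt] by auto
  then obtain i where i: "i \<in> {0, 1}" "alternating (wm \<sigma>1) (wn \<sigma>2) (Suc (Suc k)) i T1" by blast
  from neumann_angle_of_alternating[OF cont_weights i(2)]
  obtain s where s: "s \<ge> 0" "neumann_angle i (Suc k) (\<lambda>t. s * wm \<sigma>1 t) (\<lambda>t. s * wn \<sigma>2 t)" by blast
  then have "neumann_angle i (Suc k) (wm (s * \<sigma>1)) (wn (s * \<sigma>2))" by (simp add: mult.assoc)
  with i s show thesis by (intro that) auto
qed

text \<open>The quotient treats both signs of \<open>b'\<close> together: if it were at least 1,
  \<open>wn b\<close> would be a multiple of \<open>wn b'\<close> with factor at least 1,
  contradicting the monotonicity in the weight.\<close>

lemma second_parameter_order:
  assumes "k \<ge> 1" "neumann_angle i k (wm a) (wn b)" "neumann_angle j (Suc k) (wm a) (wn b')"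
    and ij: "i \<in> {0, 1}" "j \<in> {0, 1}"
  shows "b' \<noteq> 0" "b / b' < 1"
proof -
  show "b' \<noteq> 0"
  proof
    assume "b' = 0"
    \<comment> \<open>The chain has at least two points, and one of any two successive ones requires
      \<open>wn b'\<close> to be positive.\<close>
    have "alternating (wm a) (wn b') (Suc (Suc k)) j T1"
      using alternating_of_neumann_angle[OF assms(3) _ cont_weights] by simp
    then show False using ij(2) \<open>b' = 0\<close> by (auto simp: active_def)
  qed
  show "b / b' < 1"
  proof (rule ccontr)
    assume "\<not> b / b' < 1"
    moreover have "wn b = (\<lambda>t. b / b' * wn b' t)" using \<open>b' \<noteq> 0\<close> by auto
    ultimately show False
      using neumann_angle_weight_contradiction[where M = "wm a" and N = "wn b'" and c = "b / b'",
          OF cont_weights _ _ assms(3) ij] assms(2)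
      by simp
  qed
qed

end

lemma half_line_sign:
  obtains \<sigma> where "\<sigma> \<in> {1, -1 :: real}" "\<And>x. x \<in> half_line \<epsilon> \<longleftrightarrow> \<sigma> * x \<ge> 0"
proof (cases \<epsilon>)
  case Plus
  then show thesis by (intro that[of 1]) auto
next
  case Minus
  then show thesis by (intro that[of "- 1"]) auto
qed

theorem theorem2:
  fixes T1 T2 :: real and p q m n :: "real \<Rightarrow> real"
    and k :: nat and \<epsilon>1 \<epsilon>2 :: sign
  assumes "T1 < T2"
    and "continuous_on {T1..T2} p" and "continuous_on {T1..T2} q"
    and "continuous_on {T1..T2} m" and "continuous_on {T1..T2} n"
    and "\<forall>t\<in>{T1..T2}. p t > 0" and "\<forall>t\<in>{T1..T2}. q t \<ge> 0"
    and "\<exists>t\<in>{T1..T2}. m t \<noteq> 0" and "\<exists>t\<in>{T1..T2}. n t \<noteq> 0"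
    and "k \<ge> 1"
  shows "(C_gt T1 T2 p q m n k \<inter> (half_line \<epsilon>1 \<times> half_line \<epsilon>2) \<noteq> {} \<and>
          C_lt T1 T2 p q m n k \<inter> (half_line \<epsilon>1 \<times> half_line \<epsilon>2) \<noteq> {}
          \<longleftrightarrow>
          C_gt T1 T2 p q m n (k + 1) \<inter> (half_line \<epsilon>1 \<times> half_line \<epsilon>2) \<noteq> {} \<or>
          C_lt T1 T2 p q m n (k + 1) \<inter> (half_line \<epsilon>1 \<times> half_line \<epsilon>2) \<noteq> {})
         \<and>
         (\<forall>C \<in> {C_gt T1 T2 p q m n k, C_lt T1 T2 p q m n k}.
          \<forall>C' \<in> {C_gt T1 T2 p q m n (k + 1), C_lt T1 T2 p q m n (k + 1)}.
            strictly_below (half_line Plus \<times> half_line Plus) C C' \<and>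
            strictly_below (half_line Minus \<times> half_line Plus) C C' \<and>
            strictly_above (half_line Plus \<times> half_line Minus) C C' \<and>
            strictly_above (half_line Minus \<times> half_line Minus) C C')"
proof -
  interpret neumann_problem T1 T2 p q m n
    using assms by unfold_locales auto
  let ?Q = "half_line \<epsilon>1 \<times> half_line \<epsilon>2"
  obtain \<sigma>1 where \<sigma>1: "\<sigma>1 \<in> {1, -1 :: real}" "\<And>x. x \<in> half_line \<epsilon>1 \<longleftrightarrow> \<sigma>1 * x \<ge> 0"
    using half_line_sign[of \<epsilon>1] by metis
  obtain \<sigma>2 where \<sigma>2: "\<sigma>2 \<in> {1, -1 :: real}" "\<And>x. x \<in> half_line \<epsilon>2 \<longleftrightarrow> \<sigma>2 * x \<ge> 0"
    using half_line_sign[of \<epsilon>2] by metis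
  have mem_Q: "(a, b) \<in> ?Q \<longleftrightarrow> \<sigma>1 * a \<ge> 0 \<and> \<sigma>2 * b \<ge> 0" for a b
    by (simp add: \<sigma>1 \<sigma>2)
  have cone: "(r * a, r * b) \<in> ?Q" if "r \<ge> 0" "(a, b) \<in> ?Q" for r a b
    using that unfolding mem_Q by (metis mult.left_commute mult_nonneg_nonneg)
  have "(\<forall>i\<in>{0, 1}. \<exists>(a, b)\<in>?Q. neumann_angle i k (wm a) (wn b)) \<longleftrightarrow>
      (\<exists>i\<in>{0, 1}. \<exists>(a, b)\<in>?Q. neumann_angle i (k + 1) (wm a) (wn b))" (is "?all \<longleftrightarrow> ?ex")
  proof
    assume ?all
    then have "\<exists>a b. \<sigma>1 * a \<ge> 0 \<and> \<sigma>2 * b \<ge> 0 \<and> neumann_angle i k (wm a) (wn b)"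
      if "i \<in> {0, 1}" for i using that mem_Q by blast
    from neumann_angle_next[OF \<sigma>1(1) \<sigma>2(1) \<open>k \<ge> 1\<close> this]
    obtain i s where fs: "i \<in> {0, 1}" "s \<ge> 0" "neumann_angle i (Suc k) (wm (s * \<sigma>1)) (wn (s * \<sigma>2))"
      by blast
    moreover have "(s * \<sigma>1, s * \<sigma>2) \<in> ?Q"
      using fs(2) \<sigma>1(1) \<sigma>2(1) unfolding mem_Q by auto
    ultimately show ?ex
      by (intro bexI[of _ i] bexI[of _ "(s * \<sigma>1, s * \<sigma>2)"])
        (simp_all only: case_prod_conv Suc_eq_plus1)
  next
    assume ?ex
    then obtain j a b where "j \<in> {0, 1}" "(a, b) \<in> ?Q" "neumann_angle j (Suc k) (wm a) (wn b)"
      by auto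
    then show ?all using neumann_angle_between[OF cone] by blast
  qed
  then have equiv: "C_gt T1 T2 p q m n k \<inter> ?Q \<noteq> {} \<and> C_lt T1 T2 p q m n k \<inter> ?Q \<noteq> {} \<longleftrightarrow>
      C_gt T1 T2 p q m n (k + 1) \<inter> ?Q \<noteq> {} \<or> C_lt T1 T2 p q m n (k + 1) \<inter> ?Q \<noteq> {}"
    unfolding pairs_iff_neumann_angle .
  have ratio: "b' \<noteq> 0" "b / b' < 1"
    if CC: "C \<in> {C_gt T1 T2 p q m n k, C_lt T1 T2 p q m n k}"
      "C' \<in> {C_gt T1 T2 p q m n (k + 1), C_lt T1 T2 p q m n (k + 1)}"
      "(a, b) \<in> C" "(a, b') \<in> C'" for C C' a b b'
  proof -
    obtain i where i: "i \<in> {0, 1}" "neumann_angle i k (wm a) (wn b)"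
      using neumann_angle_of_mem[OF CC(1,3)] .
    obtain j where j: "j \<in> {0, 1}" "neumann_angle j (Suc k) (wm a) (wn b')"
      using neumann_angle_of_mem[OF CC(2,4)] unfolding Suc_eq_plus1 .
    show "b' \<noteq> 0" "b / b' < 1"
      by (rule second_parameter_order[OF \<open>k \<ge> 1\<close> i(2) j(2) i(1) j(1)])+
  qed
  \<comment> \<open>The sign of \<open>b'\<close> decides whether the ratio bound means strictly
    below or strictly above.\<close>
  have up: "b < b'" if "b' \<noteq> 0" "b / b' < 1" "b' \<ge> 0" for b b' :: real
    using that by (simp add: divide_less_eq)
  have down: "b > b'" if "b' \<noteq> 0" "b / b' < 1" "b' \<le> 0" for b b' :: real
    using that by (simp add: divide_less_eq)
  show ?thesis
  proof (intro conjI ballI)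
    fix C C'
    assume CC: "C \<in> {C_gt T1 T2 p q m n k, C_lt T1 T2 p q m n k}"
      "C' \<in> {C_gt T1 T2 p q m n (k + 1), C_lt T1 T2 p q m n (k + 1)}"
    note ratio' = ratio[OF CC]
    show "strictly_below (half_line Plus \<times> half_line Plus) C C'"
      "strictly_below (half_line Minus \<times> half_line Plus) C C'"
      unfolding strictly_below_def using up[OF ratio'] by fastforce+
    show "strictly_above (half_line Plus \<times> half_line Minus) C C'"
      "strictly_above (half_line Minus \<times> half_line Minus) C C'"
      unfolding strictly_above_def using down[OF ratio'] by fastforce+
  qed (rule equiv)
qed

end
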